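(* Let $\mathfrak A$ be a unital JB-algebra, $n\ge2$, $\omega=(\omega_1,\dots,\omega_n)\in\Delta_n$, and let $G_n(\omega;\cdot):\mathfrak A_{++}^n\to\mathfrak A_{++}$ be a weighted $n$-mean satisfying $$\left(\sum_{k=1}^n\omega_kA_k^{-1}\right)^{-1}\le G_n(\omega;A_1,\dots,A_n)\le\sum_{k=1}^n\omega_kA_k\qquad\text{for all }A_1,\dots,A_n\in\mathfrak A_{++}.$$ Then $G_n$ is a multivariate Lie-Trotter mean.
   Context: A (real) Jordan algebra is a real vector space $\mathfrak A$ with a bilinear product $\circ$ satisfying $A\circ B=B\circ A$ and $(A^2\circ B)\circ A=A^2\circ(B\circ A)$, where $A^2=A\circ A$. A JB-algebra is a Jordan algebra over $\mathbb R$ with a complete norm such that $\|A\circ B\|\le\|A\|\|B\|$, $\|A^2\|=\|A\|^2$ and $\|A^2\|\le\|A^2+B^2\|$. In a unital JB-algebra with unit $I$, $A$ is invertible with (Jordan) inverse $B=A^{-1}$ if $A\circ B=I$ and $A^2\circ B=A$; the spectrum of $A$ is $\{\lambda\in\mathbb R: A-\lambda I \text{ is not invertible}\}$; $A$ is positive ($A\ge0$) if its spectrum lies in $[0,\infty)$, and $A\le B$ means $B-A\ge0$. $\mathfrak A_{++}$ is the open convex cone of positive invertible elements. Real powers, $\exp$ and $\log$ are given by functional calculus in $\mathfrak A$. $\Delta_n$ denotes the set of probability vectors $\omega=(\omega_1,\dots,\omega_n)$ in $\mathbb R^n$ with all $\omega_k>0$. A weighted $n$-mean is a map $G_n(\omega;\cdot):\mathfrak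 A_{++}^n\to\mathfrak A_{++}$ with $G_n(\omega;A,\dots,A)=A$ for all $A\in\mathfrak A_{++}$. It is a multivariate Lie-Trotter mean if $\lim_{t\to0}G_n(\omega;\gamma_1(t),\dots,\gamma_n(t))^{1/t}=\exp\left(\sum_{k=1}^n\omega_k\gamma_k'(0)\right)$ for all differentiable curves $\gamma_k:(-\varepsilon,\varepsilon)\to\mathfrak A_{++}$ with $\gamma_k(0)=I$, $1\le k\le n$. *)

theory Defs
  imports "HOL-Analysis.Analysis" "HOL-Computational_Algebra.Polynomial"
begin

class jordan_algebra = real_vector +
  fixes jprod :: "'a \<Rightarrow> 'a \<Rightarrow> 'a"  (infixl "\<odot>" 70)
  assumes jprod_add_left: "(a + b) \<odot> c = a \<odot> c + b \<odot> c"
    and jprod_scaleR_left: "(r *\<^sub>R a) \<odot> b = r *\<^sub>R (a \<odot> b)"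
    and jprod_commute: "a \<odot> b = b \<odot> a"
    and jordan_identity: "((a \<odot> a) \<odot> b) \<odot> a = (a \<odot> a) \<odot> (b \<odot> a)"

class jb_algebra = jordan_algebra + banach +
  assumes norm_jprod_le: "norm (a \<odot> b) \<le> norm a * norm b"
    and norm_jsquare: "norm (a \<odot> a) = (norm a)\<^sup>2"
    and norm_jsquare_le_add: "norm (a \<odot> a) \<le> norm (a \<odot> a + b \<odot> b)"

class unital_jb_algebra = jb_algebra + one +
  assumes one_jprod: "1 \<odot> a = a"

definition is_jinverse :: "'a::unital_jb_algebra \<Rightarrow> 'a \<Rightarrow> bool" where
  "is_jinverse A B \<longleftrightarrow> A \<odot> B = 1 \<and> (A \<odot> A) \<odot> B = A"

definition jinvertible :: "'a::unital_jb_algebra \<Rightarrow> bool" where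
  "jinvertible A \<longleftrightarrow> (\<exists>B. is_jinverse A B)"

definition jinverse :: "'a::unital_jb_algebra \<Rightarrow> 'a" where
  "jinverse A = (THE B. is_jinverse A B)"

definition jspectrum :: "'a::unital_jb_algebra \<Rightarrow> real set" where
  "jspectrum A = {r. \<not> jinvertible (A - r *\<^sub>R 1)}"

definition jpositive :: "'a::unital_jb_algebra \<Rightarrow> bool" where
  "jpositive A \<longleftrightarrow> jspectrum A \<subseteq> {0..}"

definition jle :: "'a::unital_jb_algebra \<Rightarrow> 'a \<Rightarrow> bool"  (infix "\<preceq>" 50) where
  "A \<preceq> B \<longleftrightarrow> jpositive (B - A)"

definition pos_cone :: "'a::unital_jb_algebra set" where
  "pos_cone = {A. jpositive A \<and> jinvertible A}"

primrec jpower :: "'a::unital_jb_algebra \<Rightarrow> nat \<Rightarrow> 'a" where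
  "jpower A 0 = 1"
| "jpower A (Suc m) = A \<odot> jpower A m"

definition jpoly :: "real poly \<Rightarrow> 'a::unital_jb_algebra \<Rightarrow> 'a" where
  "jpoly p A = (\<Sum>i\<le>degree p. coeff p i *\<^sub>R jpower A i)"

text \<open>Continuous functional calculus: the extension of polynomial evaluation at \<open>A\<close> to those
  functions that are uniform limits of polynomials on the spectrum of \<open>A\<close>, that is, to the
  functions continuous there. For other functions the value is unspecified.\<close>

definition jcalc :: "(real \<Rightarrow> real) \<Rightarrow> 'a::unital_jb_algebra \<Rightarrow> 'a" where
  "jcalc f A = (THE B. \<forall>p :: nat \<Rightarrow> real poly.
     uniform_limit (jspectrum A) (\<lambda>m. poly (p m)) f sequentially \<longrightarrow>
     (\<lambda>m. jpoly (p m) A) \<longlonglongrightarrow> B)"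

definition jexp :: "'a::unital_jb_algebra \<Rightarrow> 'a" where
  "jexp A = jcalc exp A"

definition jpowr :: "'a::unital_jb_algebra \<Rightarrow> real \<Rightarrow> 'a" where
  "jpowr A s = jcalc (\<lambda>x. x powr s) A"

definition prob_vectors :: "(real ^ 'n) set" where
  "prob_vectors = {w. (\<forall>k. w $ k > 0) \<and> (\<Sum>k\<in>UNIV. w $ k) = 1}"

text \<open>Below, \<open>G\<close> is the \<open>n\<close>-mean at one fixed weight vector; only its values on tuples from
  \<open>pos_cone\<close> matter.\<close>

definition weighted_mean :: "('a::unital_jb_algebra ^ 'n \<Rightarrow> 'a) \<Rightarrow> bool" where
  "weighted_mean G \<longleftrightarrow>
     (\<forall>A. (\<forall>k. A $ k \<in> pos_cone) \<longrightarrow> G A \<in> pos_cone) \<and>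
     (\<forall>A\<in>pos_cone. G (\<chi> k. A) = A)"

definition lie_trotter_mean ::
    "real ^ 'n \<Rightarrow> ('a::unital_jb_algebra ^ 'n \<Rightarrow> 'a) \<Rightarrow> bool" where
  "lie_trotter_mean w G \<longleftrightarrow> weighted_mean G \<and>
     (\<forall>(\<gamma> :: 'n \<Rightarrow> real \<Rightarrow> 'a) e. e > 0 \<longrightarrow>
        (\<forall>k. \<gamma> k ` {-e<..<e} \<subseteq> pos_cone \<and> \<gamma> k differentiable_on {-e<..<e} \<and> \<gamma> k 0 = 1) \<longrightarrow>
        ((\<lambda>t. jpowr (G (\<chi> k. \<gamma> k t)) (1 / t)) \<longlongrightarrow>
           jexp (\<Sum>k\<in>UNIV. w $ k *\<^sub>R vector_derivative (\<gamma> k) (at 0))) (at 0))"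

end

theory Submission
  imports Defs "HOL-Computational_Algebra.Fundamental_Theorem_Algebra"
begin

text \<open>
  Along differentiable curves through the unit, the weighted arithmetic mean and the weighted harmonic
  mean are both of the form \<open>1 + t D + o(t)\<close>, where \<open>D\<close> is the weighted sum of the velocities: for the
  harmonic mean because inversion has derivative \<open>-1\<close> at the unit and is applied twice. A mean squeezed
  between the two has the same expansion, because the norm is monotone on the positive cone
  (\<open>has_tangent_at_one_squeeze\<close>). Finally \<open>(1 + t D + o(t))\<^bsup>1/t\<^esup>\<close> tends to \<open>exp D\<close>
  (\<open>tendsto_jpowr_inverse\<close>), because \<open>(1 + t x)\<^bsup>1/t\<^esup>\<close> tends to \<open>exp x\<close> uniformly for bounded \<open>x\<close>.

  The work lies in deriving the order and the functional calculus from the axioms. By the Jordan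
  identity, the closed subalgebra generated by one element is associative, and its multiplication
  operators commute on the whole algebra. In it, Banach's fixed point theorem yields the inverse and the square
  root of \<open>1 - c\<close> for \<open>norm c < 1\<close>. The axiom \<open>norm (a\<^sup>2) \<le> norm (a\<^sup>2 + b\<^sup>2)\<close> then shows that
  \<open>b\<^sup>2 + s\<close> is invertible for \<open>s > 0\<close> and that, unless the algebra is zero, \<open>b\<^sup>2 - (norm b)\<^sup>2\<close> is not. Factoring real polynomials
  into linear and quadratic factors, these two facts bound the norm of a polynomial in \<open>a\<close> by its supremum
  on the spectrum (\<open>norm_jpoly_le\<close>), without complexification and without Gelfand theory. The spectrum is
  defined by Jordan inverses in the whole algebra; it agrees with the spectrum in the generated
  subalgebra (\<open>jinvertible_iff_unit_in\<close>) because an element with a Jordan inverse anywhere is bounded below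
  on that subalgebra.
\<close>

section \<open>Linearized Jordan identities\<close>

text \<open>
  The Jordan identity says that a cubic map in \<open>a\<close> vanishes. A cubic map that vanishes everywhere
  has a vanishing symmetric trilinear polarization, and that polarization is this identity.
\<close>

lemma jordan_identity_linearized:
  fixes a b c d :: "'a::jordan_algebra"
  shows "a \<odot> ((b \<odot> c) \<odot> d) + b \<odot> ((c \<odot> a) \<odot> d) + c \<odot> ((a \<odot> b) \<odot> d) =
    (b \<odot> c) \<odot> (a \<odot> d) + (c \<odot> a) \<odot> (b \<odot> d) + (a \<odot> b) \<odot> (c \<odot> d)"
proof -
  have add_right: "x \<odot> (y + z) = x \<odot> y + x \<odot> z" for x y z :: 'a
    by (metis jprod_add_left jprod_commute)
  define t where "t x y z = x \<odot> ((y \<odot> z) \<odot> d) - (y \<odot> z) \<odot> (x \<odot> d)" for x y z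
  have J: "t x x x = 0" for x
    using jordan_identity[of x d] by (simp add: t_def jprod_commute)
  have t1: "t (x + x') y z = t x y z + t x' y z"
   and t2: "t y (x + x') z = t y x z + t y x' z"
   and t3: "t y z (x + x') = t y z x + t y z x'" for x x' y z
    by (simp_all add: t_def jprod_add_left add_right)
  have sym: "t x y z = t x z y" for x y z by (simp add: t_def jprod_commute)
  \<comment> \<open>Inclusion-exclusion extracts the part of the cubic form that is linear in each of a, b and c.\<close>
  have "2 *\<^sub>R (t a b c + t b c a + t c a b) = t (a+b+c) (a+b+c) (a+b+c) - t (a+b) (a+b) (a+b)
     - t (b+c) (b+c) (b+c) - t (a+c) (a+c) (a+c) + t a a a + t b b b + t c c c"
    by (simp only: t1 t2 t3 sym[of a c b] sym[of b c a] sym[of c b a] scaleR_2) (simp add: algebra_simps sym)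
  also have "\<dots> = 0" by (simp only: J) simp
  finally have "t a b c + t b c a + t c a b = 0" by simp
  then show ?thesis by (simp add: t_def algebra_simps)
qed

text \<open>
  The right-hand side of the linearized identity is symmetric in all four variables, the left-hand
  side only visibly in three. Comparing the identity with the one in which \<open>a\<close> and \<open>d\<close> are
  exchanged expresses multiplication by a threefold product through multiplications by single and
  twofold products.
\<close>

lemma jprod_mult_operator:
  fixes a b c d :: "'a::jordan_algebra"
  shows "((b \<odot> c) \<odot> a) \<odot> d = (b \<odot> c) \<odot> (a \<odot> d) + (c \<odot> a) \<odot> (b \<odot> d) + (a \<odot> b) \<odot> (c \<odot> d)
    - b \<odot> (a \<odot> (c \<odot> d)) - c \<odot> (a \<odot> (b \<odot> d))"
  using jordan_identity_linearized[of a b c d] jordan_identity_linearized[of d b c a]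
  by (simp add: jprod_commute algebra_simps)

interpretation jprod: bounded_bilinear "(\<odot>) :: 'a::jb_algebra \<Rightarrow> 'a \<Rightarrow> 'a"
proof
  fix a a' b b' :: 'a and r :: real
  show "(a + a') \<odot> b = a \<odot> b + a' \<odot> b" by (rule jprod_add_left)
  then show "a \<odot> (b + b') = a \<odot> b + a \<odot> b'" by (metis jprod_add_left jprod_commute)
  show "(r *\<^sub>R a) \<odot> b = r *\<^sub>R (a \<odot> b)" by (rule jprod_scaleR_left)
  show "a \<odot> (r *\<^sub>R b) = r *\<^sub>R (a \<odot> b)" by (metis jprod_scaleR_left jprod_commute)
  show "\<exists>K. \<forall>a b::'a. norm (a \<odot> b) \<le> norm a * norm b * K"
    by (rule exI[of _ 1]) (simp add: norm_jprod_le)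
qed

declare one_jprod [simp]

lemma jprod_one [simp]: "a \<odot> 1 = (a::'a::unital_jb_algebra)"
  by (metis jprod_commute one_jprod)

lemma norm_one_le: "norm (1::'a::unital_jb_algebra) \<le> 1"
proof -
  have "norm (1::'a) * (norm (1::'a) - 1) = 0"
    using norm_jsquare[of "1::'a"] by (simp add: power2_eq_square algebra_simps)
  then show ?thesis by auto
qed

section \<open>Powers and polynomials of one element\<close>

text \<open>
  A second-order recursion for the operators of multiplication by \<open>x\<^sup>n\<close>: they are all
  polynomials in multiplication by \<open>x\<close> and multiplication by \<open>x \<odot> x\<close>. Every later statement about
  all powers of \<open>x\<close> comes down to these two operators.
\<close>

lemma jpower_Suc_Suc_jprod:
  fixes x d :: "'a::unital_jb_algebra"
  shows "jpower x (Suc (Suc n)) \<odot> d = 2 *\<^sub>R (jpower x (Suc n) \<odot> (x \<odot> d)) + (x \<odot> x) \<odot> (jpower x n \<odot> d)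
    - x \<odot> (x \<odot> (jpower x n \<odot> d)) - jpower x n \<odot> (x \<odot> (x \<odot> d))"
  using jprod_mult_operator[of x "jpower x n" x d] by (simp add: jprod_commute scaleR_2)

definition op_commute :: "'a::jordan_algebra \<Rightarrow> 'a \<Rightarrow> bool" where
  "op_commute u v \<longleftrightarrow> (\<forall>z. u \<odot> (v \<odot> z) = v \<odot> (u \<odot> z))"

lemma op_commute_jpower_if:
  fixes u x :: "'a::unital_jb_algebra"
  assumes "op_commute u x" and "op_commute u (x \<odot> x)"
  shows "op_commute u (jpower x n)"
proof (induction n rule: less_induct)
  case (less n)
  consider "n = 0" | "n = 1" | m where "n = Suc (Suc m)"
    by (metis One_nat_def not0_implies_Suc)
  then show ?case
  proof cases
    case 3
    then have IH: "u \<odot> (jpower x m \<odot> z) = jpower x m \<odot> (u \<odot> z)"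
      "u \<odot> (jpower x (Suc m) \<odot> z) = jpower x (Suc m) \<odot> (u \<odot> z)" for z
      using less[of m] less[of "Suc m"] by (auto simp: op_commute_def)
    have ux: "u \<odot> (x \<odot> z) = x \<odot> (u \<odot> z)" "u \<odot> ((x \<odot> x) \<odot> z) = (x \<odot> x) \<odot> (u \<odot> z)" for z
      using assms by (auto simp: op_commute_def)
    show ?thesis
      unfolding op_commute_def 3 jpower_Suc_Suc_jprod
      by (simp only: jprod.add_right jprod.diff_right jprod.scaleR_right IH ux simp_thms)
  qed (use assms in \<open>auto simp: op_commute_def\<close>)
qed

lemma op_commute_sym: "op_commute u v \<Longrightarrow> op_commute v u"
  by (simp add: op_commute_def)

text \<open>
  The two operators from which all the others are built commute; this is the Jordan identity itself.
\<close>

lemma op_commute_jpower: "op_commute (jpower x m) (jpower (x::'a::unital_jb_algebra) n)"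
proof -
  have refl: "op_commute u u" for u :: 'a by (simp add: op_commute_def)
  have x2: "op_commute x (x \<odot> x)"
    using jordan_identity[of x] by (simp add: op_commute_def jprod_commute)
  have "op_commute x (jpower x m)" and "op_commute (x \<odot> x) (jpower x m)" for m
    using op_commute_jpower_if x2 refl op_commute_sym by blast+
  then show ?thesis
    using op_commute_jpower_if op_commute_sym by blast
qed

lemma jpoly_eq_sum:
  fixes x :: "'a::unital_jb_algebra"
  assumes "degree p \<le> n"
  shows "jpoly p x = (\<Sum>i\<le>n. coeff p i *\<^sub>R jpower x i)"
  unfolding jpoly_def using assms
  by (intro sum.mono_neutral_left) (auto simp: coeff_eq_0)

lemma jpoly_add: "jpoly (p + q) x = jpoly p x + jpoly q (x::'a::unital_jb_algebra)"
proof -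
  define n where "n = max (degree p) (degree q)"
  have "degree (p + q) \<le> n" "degree p \<le> n" "degree q \<le> n"
    using degree_add_le_max[of p q] by (auto simp: n_def)
  then show ?thesis
    by (simp add: jpoly_eq_sum[of _ n] sum.distrib scaleR_left_distrib)
qed

lemma jpoly_smult: "jpoly (smult c p) x = c *\<^sub>R jpoly p (x::'a::unital_jb_algebra)"
  by (simp add: jpoly_eq_sum[of "smult c p" "degree p"] jpoly_def scaleR_sum_right degree_smult_le)

lemma jpoly_pCons: "jpoly (pCons c p) x = c *\<^sub>R 1 + x \<odot> jpoly p (x::'a::unital_jb_algebra)"
proof -
  have "jpoly (pCons c p) x = (\<Sum>i\<le>Suc (degree p). coeff (pCons c p) i *\<^sub>R jpower x i)"
    by (rule jpoly_eq_sum) (simp add: degree_pCons_le)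
  also have "\<dots> = c *\<^sub>R 1 + (\<Sum>i\<le>degree p. coeff p i *\<^sub>R (x \<odot> jpower x i))"
    by (subst sum.atMost_Suc_shift) simp
  finally show ?thesis
    by (simp add: jpoly_def jprod.sum_right jprod.scaleR_right)
qed

lemma jpoly_0: "jpoly 0 x = (0::'a::unital_jb_algebra)"
  by (simp add: jpoly_def)

lemma jpoly_const: "jpoly [:c:] x = c *\<^sub>R (1::'a::unital_jb_algebra)"
  by (simp add: jpoly_def)

lemma jpoly_linear: "jpoly [:c, d:] x = c *\<^sub>R 1 + d *\<^sub>R (x::'a::unital_jb_algebra)"
  by (simp add: jpoly_pCons jpoly_0 jprod.zero_right jprod.scaleR_right)

lemma jpoly_diff: "jpoly (p - q) x = jpoly p x - jpoly q (x::'a::unital_jb_algebra)"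
  using jpoly_add[of p "smult (-1) q" x] jpoly_smult[of "-1" q x] by simp

lemma op_commute_jpoly: "jpoly p x \<odot> (jpoly q x \<odot> z) = jpoly q x \<odot> (jpoly p (x::'a::unital_jb_algebra) \<odot> z)"
proof -
  have "jpower x i \<odot> (jpower x j \<odot> z) = jpower x j \<odot> (jpower x i \<odot> z)" for i j
    using op_commute_jpower[of x i j] by (simp add: op_commute_def)
  then show ?thesis
    unfolding jpoly_def
    by (simp add: jprod.sum_left jprod.sum_right jprod.scaleR_left jprod.scaleR_right scaleR_sum_right
        sum.swap[of _ "{..degree p}"] mult.commute)
qed

text \<open>
  Power associativity. In the induction step the factor \<open>x\<close> of \<open>x \<odot> p x\<close> is pulled out of the product
  with \<open>q x\<close>, since multiplication by \<open>x\<close> and by \<open>q x\<close> commute.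
\<close>

lemma jpoly_mult: "jpoly (p * q) x = jpoly p x \<odot> jpoly q (x::'a::unital_jb_algebra)"
proof (induction p)
  case (pCons c p)
  have "x \<odot> (jpoly p x \<odot> jpoly q x) = jpoly q x \<odot> (x \<odot> jpoly p x)"
    using op_commute_jpoly[of "[:0, 1:]" x q "jpoly p x"]
    by (simp add: jpoly_linear jprod_commute[of "jpoly p x"])
  then show ?case
    using pCons by (simp add: mult_pCons_left jpoly_add jpoly_smult jpoly_pCons jprod.add_left jprod.scaleR_left
      jprod_commute[of "jpoly q x"])
qed (simp add: jpoly_0 jprod.zero_left)

lemma jpoly_pcompose: "jpoly (pcompose p q) x = jpoly p (jpoly q (x::'a::unital_jb_algebra))"
  by (induction p) (simp_all add: jpoly_0 pcompose_pCons jpoly_add jpoly_mult jpoly_const jpoly_pCons jprod.zero_right)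

lemma tendsto_jpoly:
  fixes X :: "'b \<Rightarrow> 'a::unital_jb_algebra"
  assumes "(X \<longlongrightarrow> D) F"
  shows "((\<lambda>t. jpoly p (X t)) \<longlongrightarrow> jpoly p D) F"
  by (induction p) (auto simp: jpoly_0 jpoly_pCons intro!: tendsto_intros jprod.tendsto assms)

section \<open>Square roots and inverses in commuting subalgebras\<close>

text \<open>
  A closed unital subalgebra whose multiplication operators commute on the whole algebra, not only on
  the subalgebra. The stronger form makes the subalgebra associative, and it is also what allows
  elements outside the subalgebra, such as an arbitrary Jordan inverse, to be compared with elements
  inside.
\<close>

locale commuting_subalgebra =
  fixes S :: "'a::unital_jb_algebra set"
  assumes closed: "closed S"
    and subspace: "subspace S"
    and one_mem: "1 \<in> S"
    and prod_mem: "u \<in> S \<Longrightarrow> v \<in> S \<Longrightarrow> u \<odot> v \<in> S"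
    and commuting: "u \<in> S \<Longrightarrow> v \<in> S \<Longrightarrow> op_commute u v"
begin

lemma add_mem: "u \<in> S \<Longrightarrow> v \<in> S \<Longrightarrow> u + v \<in> S"
  and diff_mem: "u \<in> S \<Longrightarrow> v \<in> S \<Longrightarrow> u - v \<in> S"
  and scaleR_mem: "u \<in> S \<Longrightarrow> r *\<^sub>R u \<in> S"
  using subspace by (auto simp: subspace_add subspace_diff subspace_scale)

lemmas mem = add_mem diff_mem scaleR_mem one_mem prod_mem

lemma jprod_left_commute: "u \<in> S \<Longrightarrow> v \<in> S \<Longrightarrow> u \<odot> (v \<odot> z) = v \<odot> (u \<odot> z)"
  using commuting by (auto simp: op_commute_def)

lemma jprod_assoc: "u \<in> S \<Longrightarrow> w \<in> S \<Longrightarrow> (u \<odot> v) \<odot> w = u \<odot> (v \<odot> w)"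
  using jprod_left_commute[of w u v] by (simp add: jprod_commute)

lemma jprod_mult_mult:
  assumes "u \<in> S" "v \<in> S" "u' \<in> S" "v' \<in> S"
  shows "(u \<odot> v) \<odot> (u' \<odot> v') = (u \<odot> u') \<odot> (v \<odot> v')"
  using assms by (simp add: jprod_assoc jprod_left_commute mem)

text \<open>
  Invertibility inside the associative subalgebra. That this agrees with Jordan invertibility in the
  whole algebra is the last lemma about the locale.
\<close>

definition unit_in :: "'a \<Rightarrow> bool" where
  "unit_in x \<longleftrightarrow> (\<exists>b\<in>S. x \<odot> b = 1)"

lemma unit_in_mult_iff:
  assumes "x \<in> S" "z \<in> S"
  shows "unit_in (x \<odot> z) \<longleftrightarrow> unit_in x \<and> unit_in z"
proof
  assume "unit_in (x \<odot> z)"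
  then obtain b where b: "b \<in> S" "(x \<odot> z) \<odot> b = 1" by (auto simp: unit_in_def)
  have "x \<odot> (z \<odot> b) = 1" "z \<odot> (x \<odot> b) = 1"
    using b assms by (simp_all add: jprod_assoc jprod_left_commute[of z x])
  then show "unit_in x \<and> unit_in z"
    unfolding unit_in_def using b(1) assms prod_mem by metis
next
  assume "unit_in x \<and> unit_in z"
  then obtain b c where "b \<in> S" "x \<odot> b = 1" "c \<in> S" "z \<odot> c = 1" by (auto simp: unit_in_def)
  then show "unit_in (x \<odot> z)"
    unfolding unit_in_def using assms by (intro bexI[of _ "b \<odot> c"]) (simp_all add: jprod_mult_mult[of x z b c] mem)
qed

text \<open>
  The Neumann series, in the form of the fixed point of the contraction \<open>b \<mapsto> 1 + c \<odot> b\<close>.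
\<close>

lemma unit_in_one_diff:
  assumes "c \<in> S" "norm c < 1"
  shows "unit_in (1 - c)"
proof -
  have "\<exists>!b\<in>S. 1 + c \<odot> b = b"
  proof (rule Banach_fix[of S "norm c"])
    fix x y assume "x \<in> S" "y \<in> S"
    show "dist (1 + c \<odot> x) (1 + c \<odot> y) \<le> norm c * dist x y"
      using norm_jprod_le[of c "x - y"] by (simp add: dist_norm jprod.diff_right)
  qed (use assms mem closed in \<open>auto simp: complete_eq_closed\<close>)
  then obtain b where b: "b \<in> S" "1 + c \<odot> b = b" by blast
  then have "(1 - c) \<odot> b = 1"
    by (simp add: jprod.diff_left) (simp add: diff_eq_eq)
  then show ?thesis using b by (auto simp: unit_in_def)
qed

lemma unit_in_scaleR_iff: "r \<noteq> 0 \<Longrightarrow> x \<in> S \<Longrightarrow> unit_in (r *\<^sub>R x) \<longleftrightarrow> unit_in x"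
proof (rule iffI)
  assume *: "r \<noteq> 0" "x \<in> S"
  show "unit_in (r *\<^sub>R x)" if "unit_in x"
    using that * mem unfolding unit_in_def
    by (metis jprod.scaleR_left jprod.scaleR_right right_inverse scaleR_scaleR scaleR_one)
  show "unit_in x" if "unit_in (r *\<^sub>R x)"
    using that * mem unfolding unit_in_def
    by (metis jprod.scaleR_left jprod.scaleR_right)
qed

lemma unit_in_scaleR_one_diff:
  assumes "c \<in> S" "norm c < r"
  shows "unit_in (r *\<^sub>R 1 - c)"
proof -
  have r: "r > 0" using assms norm_ge_zero[of c] by linarith
  have "unit_in (1 - (1 / r) *\<^sub>R c)"
    using assms r by (intro unit_in_one_diff) (auto simp: mem divide_simps)
  then have "unit_in (r *\<^sub>R (1 - (1 / r) *\<^sub>R c))"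
    using r assms by (subst unit_in_scaleR_iff) (auto simp: mem)
  then show ?thesis using r by (simp add: scaleR_diff_right)
qed

text \<open>
  With \<open>d = 1 - x\<close> the equation \<open>d \<odot> d = 1 - c\<close> becomes \<open>x = (c + x \<odot> x) / 2\<close>. Its right-hand side is a
  contraction of the ball of radius \<open>\<rho>\<close>, where \<open>\<rho> < 1\<close> is the smaller root of the scalar equation
  \<open>\<rho> = (norm c + \<rho>\<^sup>2) / 2\<close>.
\<close>

lemma sqrt_one_diff:
  assumes "c \<in> S" "norm c < 1"
  shows "\<exists>d\<in>S. d \<odot> d = 1 - c"
proof -
  define \<rho> where "\<rho> = 1 - sqrt (1 - norm c)"
  have \<rho>: "0 \<le> \<rho>" "\<rho> < 1" using assms by (auto simp: \<rho>_def)
  have "(1 - \<rho>)\<^sup>2 = 1 - norm c" using assms by (simp add: \<rho>_def)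
  then have eq: "norm c + \<rho> * \<rho> = 2 * \<rho>" by (simp add: power2_eq_square algebra_simps)
  define f where "f x = (1/2) *\<^sub>R (c + x \<odot> x)" for x
  have "\<exists>!x\<in>S \<inter> cball 0 \<rho>. f x = x"
  proof (rule Banach_fix)
    show "complete (S \<inter> cball 0 \<rho>)" using closed by (auto simp: complete_eq_closed)
    have "0 \<in> S" using subspace by (simp add: subspace_0)
    then show "S \<inter> cball 0 \<rho> \<noteq> {}" using \<rho> by auto
    show "f ` (S \<inter> cball 0 \<rho>) \<subseteq> S \<inter> cball 0 \<rho>"
    proof (rule image_subsetI)
      fix x assume "x \<in> S \<inter> cball 0 \<rho>"
      then have x: "x \<in> S" "norm x \<le> \<rho>" by auto
      have "norm (x \<odot> x) \<le> \<rho> * \<rho>"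
        using norm_jprod_le[of x x] x \<rho> by (meson mult_mono norm_ge_zero order_trans)
      then have "norm (c + x \<odot> x) \<le> 2 * \<rho>"
        using norm_triangle_ineq[of c "x \<odot> x"] eq by linarith
      then show "f x \<in> S \<inter> cball 0 \<rho>"
        using x assms by (simp add: f_def mem)
    qed
    fix x y assume xy: "x \<in> S \<inter> cball 0 \<rho>" "y \<in> S \<inter> cball 0 \<rho>"
    have "f x - f y = (1/2) *\<^sub>R ((x - y) \<odot> (x + y))"
    proof -
      have "(x - y) \<odot> (x + y) = x \<odot> x - y \<odot> y"
        by (simp add: jprod.diff_left jprod.add_right jprod_commute[of y x])
      then show ?thesis by (simp add: f_def scaleR_add_right scaleR_diff_right)
    qed
    then have "norm (f x - f y) \<le> (1/2) * (norm (x - y) * norm (x + y))"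
      using norm_jprod_le[of "x - y" "x + y"] by simp
    also have "\<dots> \<le> (1/2) * (norm (x - y) * (\<rho> + \<rho>))"
      using xy norm_triangle_ineq[of x y] by (intro mult_left_mono) auto
    finally show "dist (f x) (f y) \<le> \<rho> * dist x y"
      by (simp add: dist_norm mult.commute)
  qed (use \<rho> in auto)
  then obtain x where x: "x \<in> S" "f x = x" by blast
  then have "c + x \<odot> x = 2 *\<^sub>R x"
    by (metis f_def scaleR_scaleR scaleR_one mult.commute nonzero_eq_divide_eq zero_neq_numeral)
  then have "(1 - x) \<odot> (1 - x) = 1 - c"
    by (simp add: jprod.diff_left jprod.diff_right scaleR_2 algebra_simps)
  then show ?thesis using x mem by blast
qed

lemma sqrt_scaleR_one_diff:
  assumes "c \<in> S" "norm c < r"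
  shows "\<exists>d\<in>S. d \<odot> d = r *\<^sub>R 1 - c"
proof -
  have r: "r > 0" using assms norm_ge_zero[of c] by linarith
  obtain d where d: "d \<in> S" "d \<odot> d = 1 - (1 / r) *\<^sub>R c"
    using sqrt_one_diff[of "(1 / r) *\<^sub>R c"] assms r by (auto simp: mem divide_simps)
  have "(sqrt r *\<^sub>R d) \<odot> (sqrt r *\<^sub>R d) = r *\<^sub>R 1 - c"
    using r d by (simp add: jprod.scaleR_left jprod.scaleR_right scaleR_diff_right)
  then show ?thesis using d mem by blast
qed

text \<open>
  Here the order axiom of the norm enters: \<open>r - b\<^sup>2\<close> is a square \<open>d\<^sup>2\<close>, so \<open>r = d\<^sup>2 + b\<^sup>2\<close> dominates \<open>d\<^sup>2\<close>
  in norm.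
\<close>

lemma norm_scaleR_one_diff_square:
  assumes "b \<in> S" "(norm b)\<^sup>2 < r"
  shows "norm (r *\<^sub>R 1 - b \<odot> b) \<le> r"
proof -
  have r: "r > 0" using assms by (smt (verit) zero_le_power2)
  obtain d where d: "d \<in> S" "d \<odot> d = r *\<^sub>R 1 - b \<odot> b"
    using sqrt_scaleR_one_diff[of "b \<odot> b" r] assms by (auto simp: norm_jsquare mem)
  have "norm (d \<odot> d) \<le> norm (d \<odot> d + b \<odot> b)" by (rule norm_jsquare_le_add)
  also have "\<dots> = r * norm (1::'a)" using d r by simp
  also have "\<dots> \<le> r" using norm_one_le[where 'a='a] r by (simp add: mult_left_le)
  finally show ?thesis by (simp add: d)
qed

text \<open>
  This makes irreducible quadratic polynomials in an element invertible, and so does the work of the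
  statement that the complex spectrum is real. It holds because \<open>b\<^sup>2 + s = (r + s) - (r - b\<^sup>2)\<close> with \<open>r - b\<^sup>2\<close> of norm at
  most \<open>r\<close>.
\<close>

lemma unit_in_square_add:
  assumes "b \<in> S" "s > 0"
  shows "unit_in (b \<odot> b + s *\<^sub>R 1)"
proof -
  define r where "r = (norm b)\<^sup>2 + 1"
  have "norm (r *\<^sub>R 1 - b \<odot> b) \<le> r"
    by (rule norm_scaleR_one_diff_square) (auto simp: r_def assms)
  then have "unit_in ((r + s) *\<^sub>R 1 - (r *\<^sub>R 1 - b \<odot> b))"
    using assms by (intro unit_in_scaleR_one_diff) (auto simp: mem)
  then show ?thesis by (simp add: scaleR_left_distrib add.commute)
qed

text \<open>
  The norm is a spectral value of \<open>b\<close> up to sign. If \<open>q = r - b\<^sup>2\<close> with \<open>r = (norm b)\<^sup>2\<close> had an inverse \<open>u\<close>,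
  then for small \<open>\<epsilon> > 0\<close> and \<open>v = \<epsilon> u\<close> the element
  \<open>q - \<epsilon> = q (1 - v) = (q + \<epsilon>) (1 - v\<^sup>2) (1 + v)\<^bsup>-2\<^esup>\<close> would be a product of squares, hence a square \<open>c\<^sup>2\<close>.
  Then \<open>r - \<epsilon> = b\<^sup>2 + c\<^sup>2\<close>, and the order axiom of the norm gives the contradiction
  \<open>r = norm (b\<^sup>2) \<le> r - \<epsilon>\<close>.
\<close>

lemma not_unit_in_norm_diff_square:
  assumes "b \<in> S" and nontriv: "(1::'a) \<noteq> 0"
  shows "\<not> unit_in ((norm b)\<^sup>2 *\<^sub>R 1 - b \<odot> b)"
proof
  define r where "r = (norm b)\<^sup>2"
  define q where "q = r *\<^sub>R 1 - b \<odot> b"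
  assume "unit_in ((norm b)\<^sup>2 *\<^sub>R 1 - b \<odot> b)"
  then obtain u where u: "u \<in> S" "q \<odot> u = 1" by (auto simp: unit_in_def q_def r_def)
  have qS: "q \<in> S" using assms by (simp add: q_def mem)
  have "r \<noteq> 0"
    using u nontriv by (auto simp: q_def r_def jprod.zero_left jprod.zero_right)
  then have r: "r > 0" by (simp add: r_def)
  define \<epsilon> where "\<epsilon> = min r (1 / (norm u + 1))"
  have u1: "norm u + 1 > 0" using norm_ge_zero[of u] by linarith
  have \<epsilon>: "\<epsilon> > 0" "\<epsilon> \<le> r" using r u1 by (auto simp: \<epsilon>_def)
  have "\<epsilon> * norm u \<le> (1 / (norm u + 1)) * norm u"
    by (rule mult_right_mono) (auto simp: \<epsilon>_def)
  also have "\<dots> < 1" using u1 by (simp add: divide_simps)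
  finally have \<epsilon>u: "\<epsilon> * norm u < 1" .
  obtain d where d: "d \<in> S" "d \<odot> d = q + \<epsilon> *\<^sub>R 1"
    using sqrt_scaleR_one_diff[of "b \<odot> b" "r + \<epsilon>"] assms \<epsilon>
    by (auto simp: norm_jsquare mem r_def q_def scaleR_left_distrib algebra_simps)
  define v where "v = \<epsilon> *\<^sub>R u"
  have v: "v \<in> S" "norm v < 1" using u \<epsilon> \<epsilon>u by (auto simp: v_def mem)
  have qv: "q \<odot> v = \<epsilon> *\<^sub>R 1" using u by (simp add: v_def jprod.scaleR_right)
  have v2: "norm (v \<odot> v) < 1" using v by (simp add: norm_jsquare power_less_one_iff)
  obtain e where e: "e \<in> S" "e \<odot> e = 1 - v \<odot> v"
    using sqrt_one_diff[of "v \<odot> v"] v v2 by (auto simp: mem)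
  obtain w where w: "w \<in> S" "(1 + v) \<odot> w = 1"
    using unit_in_one_diff[of "(-1) *\<^sub>R v"] v mem(3)[of v "-1"] by (auto simp: unit_in_def)
  have "(d \<odot> d) \<odot> w = q"
  proof -
    have "d \<odot> d = q \<odot> (1 + v)" using d qv by (simp add: jprod.add_right)
    then show ?thesis using w v qS by (simp add: jprod_assoc mem)
  qed
  moreover have "(e \<odot> e) \<odot> w = 1 - v"
  proof -
    have "e \<odot> e = (1 - v) \<odot> (1 + v)" using e by (simp add: jprod.add_right jprod.diff_left)
    then show ?thesis using w v by (simp add: jprod_assoc mem)
  qed
  ultimately have "((d \<odot> d) \<odot> w) \<odot> ((e \<odot> e) \<odot> w) = q - \<epsilon> *\<^sub>R 1"
    using qv by (simp add: jprod.diff_right)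
  moreover have "((d \<odot> d) \<odot> w) \<odot> ((e \<odot> e) \<odot> w) = ((d \<odot> e) \<odot> w) \<odot> ((d \<odot> e) \<odot> w)"
    by (simp only: jprod_mult_mult[of "d \<odot> d" w "e \<odot> e" w] jprod_mult_mult[of d d e e]
        jprod_mult_mult[of "d \<odot> e" w "d \<odot> e" w] mem d(1) e(1) w(1))
  ultimately have "b \<odot> b + ((d \<odot> e) \<odot> w) \<odot> ((d \<odot> e) \<odot> w) = (r - \<epsilon>) *\<^sub>R 1"
    by (simp add: q_def scaleR_left_diff_distrib)
  then have "r \<le> \<bar>r - \<epsilon>\<bar> * norm (1::'a)"
    using norm_jsquare_le_add[of b "(d \<odot> e) \<odot> w"] by (simp add: norm_jsquare r_def)
  also have "\<dots> \<le> \<bar>r - \<epsilon>\<bar>"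
    using norm_one_le[where 'a='a] by (simp add: mult_left_le)
  finally show False using \<epsilon> by simp
qed

text \<open>
  An element of the subalgebra with an inverse \<open>y\<close> anywhere in the algebra is not a topological
  divisor of zero. The linearized Jordan identity at \<open>x, c, y, c\<close> expresses \<open>c\<^sup>2\<close> through products that
  all contain the factor \<open>x \<odot> c\<close>.
\<close>

lemma norm_le_if_jprod_eq_one:
  assumes "x \<in> S" "c \<in> S" "x \<odot> y = 1"
  shows "norm c \<le> 3 * norm y * norm (x \<odot> c)"
proof -
  have "x \<odot> ((c \<odot> y) \<odot> c) = c \<odot> (c \<odot> (x \<odot> y))"
    using assms by (simp add: jprod_commute[of "c \<odot> y"] jprod_left_commute[of x c])
  then have "c \<odot> c + y \<odot> ((x \<odot> c) \<odot> c) = 2 *\<^sub>R ((c \<odot> y) \<odot> (x \<odot> c))"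
    using jordan_identity_linearized[of x c y c] assms by (simp add: jprod_commute scaleR_2)
  then have "c \<odot> c = 2 *\<^sub>R ((c \<odot> y) \<odot> (x \<odot> c)) - y \<odot> ((x \<odot> c) \<odot> c)"
    by (metis add_diff_cancel_right')
  then have "norm (c \<odot> c) \<le> 2 * norm ((c \<odot> y) \<odot> (x \<odot> c)) + norm (y \<odot> ((x \<odot> c) \<odot> c))"
    using norm_triangle_ineq4[of "2 *\<^sub>R ((c \<odot> y) \<odot> (x \<odot> c))"] by simp
  also have "\<dots> \<le> 2 * (norm c * norm y * norm (x \<odot> c)) + norm y * (norm (x \<odot> c) * norm c)"
  proof -
    have "norm ((c \<odot> y) \<odot> (x \<odot> c)) \<le> norm c * norm y * norm (x \<odot> c)"
      by (rule order_trans[OF norm_jprod_le mult_right_mono[OF norm_jprod_le]]) simp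
    moreover have "norm (y \<odot> ((x \<odot> c) \<odot> c)) \<le> norm y * (norm (x \<odot> c) * norm c)"
      by (rule order_trans[OF norm_jprod_le mult_left_mono[OF norm_jprod_le]]) simp
    ultimately show ?thesis by linarith
  qed
  finally have "norm c * norm c \<le> norm c * (3 * norm y * norm (x \<odot> c))"
    by (simp add: norm_jsquare power2_eq_square algebra_simps)
  then show ?thesis
    by (cases "c = 0") (auto simp: jprod.zero_right)
qed

text \<open>
  Conversely, a non-invertible element is a topological divisor of zero: otherwise the inverses \<open>c\<close> of
  \<open>x\<^sup>2 + \<epsilon>\<close> stay bounded as \<open>\<epsilon>\<close> tends to zero, so that \<open>x\<^sup>2 c = 1 - \<epsilon> c\<close> becomes invertible.
\<close>

lemma unit_in_if_bounded_below:
  assumes x: "x \<in> S" and bound: "\<And>c. c \<in> S \<Longrightarrow> norm c \<le> M * norm (x \<odot> c)"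
  shows "unit_in x"
proof -
  define K where "K = M\<^sup>2 + 1"
  have K: "K > 0" unfolding K_def by (simp add: add_nonneg_pos)
  have bound2: "norm c \<le> K * norm ((x \<odot> x) \<odot> c)" if c: "c \<in> S" for c
  proof -
    have *: "norm c \<le> \<bar>M\<bar> * norm (x \<odot> c)" if "c \<in> S" for c
      using bound[OF that] by (smt (verit) mult_right_mono norm_ge_zero abs_ge_self)
    have "norm c \<le> \<bar>M\<bar> * (\<bar>M\<bar> * norm (x \<odot> (x \<odot> c)))"
      using *[OF c] mult_left_mono[OF *[of "x \<odot> c"], of "\<bar>M\<bar>"] c x by (auto simp: mem)
    also have "\<dots> = M\<^sup>2 * norm ((x \<odot> x) \<odot> c)"
      using c x by (simp add: jprod_assoc power2_eq_square)
    also have "\<dots> \<le> K * norm ((x \<odot> x) \<odot> c)" by (simp add: K_def mult_right_mono)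
    finally show ?thesis .
  qed
  define \<epsilon> where "\<epsilon> = 1 / (4 * K)"
  have \<epsilon>: "\<epsilon> > 0" "K * \<epsilon> = 1/4" using K by (auto simp: \<epsilon>_def)
  obtain c where c: "c \<in> S" "(x \<odot> x + \<epsilon> *\<^sub>R 1) \<odot> c = 1"
    using unit_in_square_add[OF x \<epsilon>(1)] by (auto simp: unit_in_def)
  then have xc: "(x \<odot> x) \<odot> c = 1 - \<epsilon> *\<^sub>R c"
    by (simp add: jprod.add_left jprod.scaleR_left eq_diff_eq)
  have "norm (1 - \<epsilon> *\<^sub>R c) \<le> 1 + \<epsilon> * norm c"
    using norm_triangle_ineq4[of 1 "\<epsilon> *\<^sub>R c"] norm_one_le[where 'a='a] \<epsilon> by simp
  then have "K * norm ((x \<odot> x) \<odot> c) \<le> K * (1 + \<epsilon> * norm c)"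
    using K xc by simp
  then have "norm c \<le> K + norm c / 4"
    using bound2[OF c(1)] \<epsilon>(2) by (simp add: distrib_left flip: mult.assoc)
  then have "\<epsilon> * norm c \<le> \<epsilon> * (4/3 * K)"
    using \<epsilon> by (intro mult_left_mono) auto
  also have "\<epsilon> * (4/3 * K) = 4/3 * (K * \<epsilon>)" by simp
  also have "\<dots> < 1" unfolding \<epsilon>(2) by simp
  finally have "unit_in (1 - \<epsilon> *\<^sub>R c)"
    using c \<epsilon> by (intro unit_in_one_diff) (auto simp: mem)
  then have "unit_in ((x \<odot> x) \<odot> c)" by (simp add: xc)
  then show ?thesis using unit_in_mult_iff x c by (simp add: mem)
qed

text \<open>
  The spectrum of an element can therefore be computed in any commuting subalgebra that contains it.
\<close>

lemma jinvertible_iff_unit_in: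
  assumes "x \<in> S"
  shows "jinvertible x \<longleftrightarrow> unit_in x"
proof
  assume "jinvertible x"
  then obtain y where "x \<odot> y = 1" by (auto simp: jinvertible_def is_jinverse_def)
  then show "unit_in x"
    by (intro unit_in_if_bounded_below[of x "3 * norm y"] norm_le_if_jprod_eq_one assms)
next
  assume "unit_in x"
  then obtain b where "b \<in> S" "x \<odot> b = 1" by (auto simp: unit_in_def)
  then show "jinvertible x"
    using assms by (auto simp: jinvertible_def is_jinverse_def jprod_assoc)
qed

end

section \<open>The closed subalgebra generated by one element\<close>

text \<open>
  The smallest closed unital subalgebra that contains \<open>a\<close>.
\<close>

definition generated_by :: "'a::unital_jb_algebra \<Rightarrow> 'a set" where
  "generated_by a = closure (range (\<lambda>p. jpoly p a))"

lemma generated_byI: "(\<lambda>m. jpoly (p m) a) \<longlonglongrightarrow> u \<Longrightarrow> u \<in> generated_by a"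
  unfolding generated_by_def closure_sequential by (intro exI[of _ "\<lambda>m. jpoly (p m) a"]) simp

lemma generated_byE:
  assumes "u \<in> generated_by a"
  obtains p where "(\<lambda>m. jpoly (p m) a) \<longlonglongrightarrow> u"
proof -
  obtain x where x: "\<And>m. x m \<in> range (\<lambda>p. jpoly p a)" "x \<longlonglongrightarrow> u"
    using assms unfolding generated_by_def closure_sequential by blast
  then have "\<forall>m. \<exists>p. x m = jpoly p a" by blast
  then obtain p where "\<forall>m. x m = jpoly (p m) a" by metis
  then have "x = (\<lambda>m. jpoly (p m) a)" by blast
  with x that show thesis by simp
qed

lemma jpoly_mem_generated_by: "jpoly p a \<in> generated_by a"
  by (rule generated_byI[of "\<lambda>_. p"]) simp

lemma commuting_subalgebra_generated_by: "commuting_subalgebra (generated_by (a::'a::unital_jb_algebra))"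
proof
  show "closed (generated_by a)" by (simp add: generated_by_def)
  show one: "1 \<in> generated_by a"
    using jpoly_mem_generated_by[of "[:1:]" a] by (simp add: jpoly_const)
  have zero: "0 \<in> generated_by a"
    using jpoly_mem_generated_by[of 0 a] by (simp add: jpoly_0)
  have add: "u + v \<in> generated_by a" and prod: "u \<odot> v \<in> generated_by a" and comm: "op_commute u v"
    if u: "u \<in> generated_by a" and v: "v \<in> generated_by a" for u v
  proof -
    obtain p where p: "(\<lambda>m. jpoly (p m) a) \<longlonglongrightarrow> u"
      using u by (rule generated_byE)
    obtain q where q: "(\<lambda>m. jpoly (q m) a) \<longlonglongrightarrow> v"
      using v by (rule generated_byE)
    have "(\<lambda>m. jpoly (p m + q m) a) \<longlonglongrightarrow> u + v"
      using tendsto_add[OF p q] by (simp add: jpoly_add)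
    then show "u + v \<in> generated_by a" by (rule generated_byI)
    have "(\<lambda>m. jpoly (p m * q m) a) \<longlonglongrightarrow> u \<odot> v"
      using jprod.tendsto[OF p q] by (simp add: jpoly_mult)
    then show "u \<odot> v \<in> generated_by a" by (rule generated_byI)
    show "op_commute u v"
      unfolding op_commute_def
    proof
      fix z
      have "(\<lambda>m. jpoly (p m) a \<odot> (jpoly (q m) a \<odot> z)) \<longlonglongrightarrow> u \<odot> (v \<odot> z)"
        "(\<lambda>m. jpoly (q m) a \<odot> (jpoly (p m) a \<odot> z)) \<longlonglongrightarrow> v \<odot> (u \<odot> z)"
        by (intro jprod.tendsto p q tendsto_const)+
      then show "u \<odot> (v \<odot> z) = v \<odot> (u \<odot> z)"
        by (simp add: op_commute_jpoly[of "p _" a "q _"] LIMSEQ_unique)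
    qed
  qed
  show "u \<odot> v \<in> generated_by a" "op_commute u v" if "u \<in> generated_by a" "v \<in> generated_by a" for u v
    using prod comm that by blast+
  have "r *\<^sub>R u \<in> generated_by a" if "u \<in> generated_by a" for r u
    using prod[OF jpoly_mem_generated_by[of "[:r:]"] that] by (simp add: jpoly_const jprod.scaleR_left)
  then show "subspace (generated_by a)"
    using zero add by (simp add: subspace_def)
qed

lemma mem_generated_by: "a \<in> generated_by a"
  using jpoly_mem_generated_by[of "[:0, 1:]" a] by (simp add: jpoly_linear)

section \<open>The spectrum and the norm of polynomials\<close>

lemma jspectrum_iff: "r \<in> jspectrum a \<longleftrightarrow> \<not> jinvertible (jpoly [:- r, 1:] a)"
  by (simp add: jspectrum_def jpoly_linear)

lemma jinvertible_jpoly_mult: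
  "jinvertible (jpoly (p * q) a) \<longleftrightarrow> jinvertible (jpoly p a) \<and> jinvertible (jpoly q (a::'a::unital_jb_algebra))"
proof -
  interpret commuting_subalgebra "generated_by a" by (rule commuting_subalgebra_generated_by)
  show ?thesis
    by (simp add: jpoly_mult jinvertible_iff_unit_in jpoly_mem_generated_by mem unit_in_mult_iff)
qed

lemma jinvertible_jpoly_const: "c \<noteq> 0 \<Longrightarrow> jinvertible (jpoly [:c:] (a::'a::unital_jb_algebra))"
  unfolding jinvertible_def is_jinverse_def
  by (rule exI[of _ "(1 / c) *\<^sub>R 1"]) (simp add: jpoly_const jprod.scaleR_left)

lemma jinvertible_jpoly_quadratic:
  assumes "t \<noteq> 0"
  shows "jinvertible (jpoly ([:-s, 1:] * [:-s, 1:] + [:t\<^sup>2:]) (a::'a::unital_jb_algebra))"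
proof -
  interpret commuting_subalgebra "generated_by a" by (rule commuting_subalgebra_generated_by)
  have "unit_in (jpoly [:-s, 1:] a \<odot> jpoly [:-s, 1:] a + t\<^sup>2 *\<^sub>R 1)"
    by (rule unit_in_square_add) (use assms jpoly_mem_generated_by in auto)
  then show ?thesis
    by (subst jinvertible_iff_unit_in[OF jpoly_mem_generated_by]) (simp only: jpoly_add jpoly_mult jpoly_const)
qed

text \<open>
  A complex root \<open>z\<close> of a real polynomial yields a linear factor if it is real, and otherwise the
  quadratic factor \<open>(x - Re z)\<^sup>2 + (Im z)\<^sup>2\<close>, since the remainder of the division by it is a real
  polynomial of degree at most one that vanishes at a non-real point.
\<close>

lemma real_poly_factor_cases:
  fixes p :: "real poly"
  assumes "degree p > 0"
  obtains r q where "p = [:-r, 1:] * q"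
  | s t q where "t \<noteq> 0" "p = ([:-s, 1:] * [:-s, 1:] + [:t\<^sup>2:]) * q"
proof -
  let ?E = "\<lambda>p. poly (map_poly complex_of_real p)"
  have E_add: "?E (p + q) z = ?E p z + ?E q z" for p q z
  proof -
    have "map_poly complex_of_real (p + q) = map_poly of_real p + map_poly of_real q"
      by (rule poly_eqI) (simp add: coeff_map_poly)
    then show ?thesis by simp
  qed
  have E_smult: "?E (smult c p) z = of_real c * ?E p z" for c p z
    by (simp add: map_poly_smult)
  have E_mult: "?E (p * q) z = ?E p z * ?E q z" for p q z
    by (induction p) (simp_all add: mult_pCons_left map_poly_pCons E_add E_smult algebra_simps)
  have E_real: "?E p (of_real x) = of_real (poly p x)" for p x
    by (induction p) (simp_all add: map_poly_pCons)
  have "degree (map_poly complex_of_real p) > 0"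
    using assms by (simp add: degree_map_poly)
  then have "\<not> constant (?E p)" by (simp add: constant_degree)
  then obtain z where z: "?E p z = 0" using fundamental_theorem_of_algebra by blast
  show thesis
  proof (cases "Im z = 0")
    case True
    then have "z = complex_of_real (Re z)" by (simp add: complex_eq_iff)
    then have "poly p (Re z) = 0" using z E_real[of p "Re z"] by simp
    then have "[:- Re z, 1:] dvd p" by (simp add: poly_eq_0_iff_dvd)
    then show thesis using that(1) by (auto simp: dvd_def)
  next
    case False
    let ?m = "[:- Re z, 1:] * [:- Re z, 1:] + [:(Im z)\<^sup>2:] :: real poly"
    define h where "h = p mod ?m"
    have "degree h < 2"
      using degree_mod_less'[of ?m p] by (cases "h = 0") (auto simp: h_def)
    then have h: "h = [:coeff h 0, coeff h 1:]"
      by (intro poly_eqI) (auto simp: coeff_pCons coeff_eq_0 split: nat.splits)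
    have "?E ?m z = 0"
      by (simp add: map_poly_pCons complex_eq_iff power2_eq_square algebra_simps)
    moreover have "?E p z = ?E ?m z * ?E (p div ?m) z + ?E h z"
    proof -
      have "p = ?m * (p div ?m) + h" by (simp only: h_def mult_div_mod_eq)
      then show ?thesis by (metis E_add E_mult)
    qed
    ultimately have "?E h z = 0" using z by simp
    then have "of_real (coeff h 0) + z * of_real (coeff h 1) = 0"
      by (subst (asm) h) (simp add: map_poly_pCons)
    then have "coeff h 0 = 0" "coeff h 1 = 0" using False by (auto simp: complex_eq_iff)
    then have "h = 0" using h by simp
    then have "?m dvd p" by (simp only: h_def mod_eq_0_iff_dvd)
    then obtain q where "p = ?m * q" by (rule dvdE)
    then show thesis by (rule that(2)[OF False])
  qed
qed

text \<open>
  If both \<open>a - norm a\<close> and \<open>a + norm a\<close> were invertible, so would be their product \<open>a\<^sup>2 - (norm a)\<^sup>2\<close>, which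
  is not.
  In the zero algebra the spectrum is empty, which is why \<open>1 \<noteq> 0\<close> is assumed.
\<close>

lemma norm_mem_jspectrum:
  assumes "(1::'a::unital_jb_algebra) \<noteq> 0"
  shows "norm (a::'a) \<in> jspectrum a \<or> - norm a \<in> jspectrum a"
proof (rule ccontr)
  interpret commuting_subalgebra "generated_by a" by (rule commuting_subalgebra_generated_by)
  let ?n = "norm a"
  assume "\<not> ?thesis"
  then have "jinvertible (jpoly ([:- ?n, 1:] * [:?n, 1:]) a)"
    unfolding jinvertible_jpoly_mult by (simp add: jspectrum_iff)
  moreover have "jpoly ([:- ?n, 1:] * [:?n, 1:]) a = (-1) *\<^sub>R (?n\<^sup>2 *\<^sub>R 1 - a \<odot> a)"
    by (simp add: jpoly_pCons jpoly_0 jprod.zero_right power2_eq_square)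
  ultimately have "unit_in ((-1) *\<^sub>R (?n\<^sup>2 *\<^sub>R 1 - a \<odot> a))"
    using jinvertible_iff_unit_in[OF jpoly_mem_generated_by] by metis
  then have "unit_in (?n\<^sup>2 *\<^sub>R 1 - a \<odot> a)"
    by (subst (asm) unit_in_scaleR_iff) (simp_all add: mem mem_generated_by)
  then show False
    using not_unit_in_norm_diff_square[OF mem_generated_by assms] by simp
qed

text \<open>
  One half of the spectral mapping theorem. A product of invertible factors is invertible, and the
  irreducible quadratic factors are invertible, so some linear factor \<open>x - r\<close> must fail to be. For the
  zero polynomial the claim is that the spectrum is not empty.
\<close>

lemma jspectrum_jpoly_zero:
  assumes "\<not> jinvertible (jpoly p a)" and "(1::'a::unital_jb_algebra) \<noteq> 0"
  shows "\<exists>r\<in>jspectrum (a::'a). poly p r = 0"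
  using assms(1)
proof (induction "degree p" arbitrary: p rule: less_induct)
  case less
  show ?case
  proof (cases "p = 0")
    case True
    then show ?thesis using norm_mem_jspectrum[OF assms(2), of a] by auto
  next
    case p: False
    show ?thesis
    proof (cases "degree p = 0")
      case True
      then obtain c where "p = [:c:]" by (rule degree_eq_zeroE)
      then show ?thesis using p less.prems jinvertible_jpoly_const by auto
    next
      case False
      then have "degree p > 0" by simp
      then show ?thesis
      proof (cases rule: real_poly_factor_cases)
        case (1 r q)
        then show ?thesis
        proof (cases "r \<in> jspectrum a")
          case False
          then have "\<not> jinvertible (jpoly q a)" using less.prems 1 by (simp only: jinvertible_jpoly_mult jspectrum_iff simp_thms)
          moreover have "degree q < degree p" using 1 p by (subst 1) (simp add: degree_mult_eq del: mult_pCons_left)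
          ultimately show ?thesis using less.hyps 1 by auto
        qed (auto simp: 1)
      next
        case (2 s t q)
        then have "\<not> jinvertible (jpoly q a)" using less.prems jinvertible_jpoly_quadratic[OF 2(1)]
            jinvertible_jpoly_mult[of _ q a] by metis
        moreover have "degree q < degree p"
          using p by (subst 2(2), subst degree_mult_eq) (auto simp: 2)
        ultimately obtain r where "r \<in> jspectrum a" "poly q r = 0" using less.hyps by blast
        then show ?thesis by (intro bexI[of _ r]) (simp_all only: 2 poly_mult mult_zero_right)
      qed
    qed
  qed
qed

text \<open>
  The spectral theorem in the form needed for the functional calculus: evaluation at \<open>a\<close> is contractive
  for the supremum norm on the spectrum, because \<open>norm (p a)\<close> is up to sign a spectral value of \<open>p a\<close>,
  hence a value of \<open>p\<close> on the spectrum of \<open>a\<close>.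
\<close>

lemma norm_jpoly_le:
  fixes a :: "'a::unital_jb_algebra"
  assumes "\<And>r. r \<in> jspectrum a \<Longrightarrow> \<bar>poly p r\<bar> \<le> M" and "0 \<le> M"
  shows "norm (jpoly p a) \<le> M"
proof (cases "(1::'a) = 0")
  case True
  then have "x = 0" for x :: 'a by (metis one_jprod jprod.zero_left)
  then show ?thesis using assms by (metis norm_zero)
next
  case False
  let ?n = "norm (jpoly p a)"
  obtain \<mu> where \<mu>: "\<mu> \<in> jspectrum (jpoly p a)" "\<bar>\<mu>\<bar> = ?n"
    using norm_mem_jspectrum[OF False, of "jpoly p a"] by auto
  have "\<not> jinvertible (jpoly (p - [:\<mu>:]) a)"
    using \<mu> by (simp add: jspectrum_def jpoly_diff jpoly_const)
  then show ?thesis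
    using jspectrum_jpoly_zero[OF _ False] assms \<mu> by fastforce
qed

text \<open>
  By the Neumann series \<open>a - r = (a - c) - (r - c)\<close> is invertible as soon as \<open>\<bar>r - c\<bar>\<close> exceeds the distance
  of \<open>a\<close> from \<open>c\<close>. General centres \<open>c\<close> serve to confine the spectra of elements near the unit, and of
  positive elements, to one side of \<open>0\<close>.
\<close>

lemma jspectrum_subset: "jspectrum a \<subseteq> {c - norm (a - c *\<^sub>R 1) .. c + norm (a - c *\<^sub>R (1::'a::unital_jb_algebra))}"
proof
  interpret commuting_subalgebra "generated_by a" by (rule commuting_subalgebra_generated_by)
  fix r assume r: "r \<in> jspectrum a"
  note a = mem_generated_by[of a]
  let ?d = "a - c *\<^sub>R 1"
  have d: "?d \<in> generated_by a" "(-1) *\<^sub>R ?d \<in> generated_by a"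
    using a by (auto intro!: mem simp del: scaleR_minus_left)
  have not_unit: "\<not> unit_in (a - r *\<^sub>R 1)"
    using r a by (simp add: jspectrum_def jinvertible_iff_unit_in mem)
  have "\<not> norm ?d < r - c"
  proof
    assume "norm ?d < r - c"
    then have "unit_in ((r - c) *\<^sub>R 1 - ?d)"
      using d by (intro unit_in_scaleR_one_diff) auto
    then have "unit_in ((-1) *\<^sub>R ((r - c) *\<^sub>R 1 - ?d))"
      using d a by (subst unit_in_scaleR_iff) (auto intro!: mem)
    moreover have "(-1) *\<^sub>R ((r - c) *\<^sub>R 1 - ?d) = a - r *\<^sub>R 1"
      by (simp add: scaleR_left_diff_distrib)
    ultimately show False using not_unit by (simp only:)
  qed
  moreover have "\<not> norm ?d < c - r"
  proof
    assume "norm ?d < c - r"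
    then have "norm ((-1) *\<^sub>R ?d) < c - r" by (simp only: norm_scaleR)
    then have "unit_in ((c - r) *\<^sub>R 1 - (-1) *\<^sub>R ?d)"
      by (rule unit_in_scaleR_one_diff[OF d(2)])
    moreover have "(c - r) *\<^sub>R 1 - (-1) *\<^sub>R ?d = a - r *\<^sub>R 1"
      by (simp add: scaleR_left_diff_distrib)
    ultimately show False using not_unit by (simp only:)
  qed
  ultimately show "r \<in> {c - norm ?d .. c + norm ?d}" by auto
qed

section \<open>The positive cone\<close>

lemma jinvertible_uminus: "jinvertible (- x) \<longleftrightarrow> jinvertible (x::'a::unital_jb_algebra)"
proof -
  have *: "is_jinverse (- x) (- y)" if "is_jinverse x y" for x y :: 'a
    using that by (simp add: is_jinverse_def jprod.minus_left jprod.minus_right)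
  show ?thesis unfolding jinvertible_def using * by (metis minus_minus)
qed

lemma jspectrum_scaleR_one_diff:
  "\<mu> \<in> jspectrum (r *\<^sub>R 1 - x) \<longleftrightarrow> r - \<mu> \<in> jspectrum (x::'a::unital_jb_algebra)"
proof -
  have "r *\<^sub>R 1 - x - \<mu> *\<^sub>R 1 = - (x - (r - \<mu>) *\<^sub>R 1)"
    by (simp add: scaleR_left_diff_distrib)
  then show ?thesis by (simp only: jspectrum_def mem_Collect_eq jinvertible_uminus)
qed

lemma trivial_algebra: "(1::'a::unital_jb_algebra) = 0 \<Longrightarrow> (x::'a) = 0"
  by (metis one_jprod jprod.zero_left)

lemma jpositive_if_norm_le:
  assumes "norm (r *\<^sub>R 1 - x) \<le> r"
  shows "jpositive (x::'a::unital_jb_algebra)"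
  using jspectrum_subset[of x r] assms
  by (fastforce simp: jpositive_def norm_minus_commute[of x])

text \<open>
  Together with the converse above this describes the positive elements by a norm inequality, from which
  the closure of the positive cone under addition is immediate.
\<close>

lemma norm_le_if_jpositive:
  assumes "jpositive x" and "norm x \<le> r"
  shows "norm (r *\<^sub>R 1 - (x::'a::unital_jb_algebra)) \<le> r"
proof (cases "(1::'a) = 0")
  case True
  then show ?thesis using trivial_algebra[OF True] assms by (metis norm_zero)
next
  case False
  let ?n = "norm (r *\<^sub>R 1 - x)"
  have "r - ?n \<in> jspectrum x \<or> r + ?n \<in> jspectrum x"
    using norm_mem_jspectrum[OF False, of "r *\<^sub>R 1 - x"] by (simp add: jspectrum_scaleR_one_diff)
  moreover have "s \<ge> 0" "s \<le> norm x" if "s \<in> jspectrum x" for s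
    using that assms jspectrum_subset[of x 0] by (auto simp: jpositive_def)
  ultimately show ?thesis using assms by force
qed

lemma jpositive_add:
  assumes "jpositive x" "jpositive y"
  shows "jpositive (x + y :: 'a::unital_jb_algebra)"
proof (rule jpositive_if_norm_le)
  have "(norm x + norm y) *\<^sub>R 1 - (x + y) = (norm x *\<^sub>R 1 - x) + (norm y *\<^sub>R 1 - y)"
    by (simp add: scaleR_left_distrib)
  then show "norm ((norm x + norm y) *\<^sub>R 1 - (x + y)) \<le> norm x + norm y"
    using norm_triangle_mono[OF norm_le_if_jpositive[OF assms(1) order_refl] norm_le_if_jpositive[OF assms(2) order_refl]]
    by (simp only:)
qed

text \<open>
  From \<open>0 \<preceq> u \<preceq> v \<preceq> norm v\<close> the spectrum of \<open>u\<close> lies between \<open>0\<close> and \<open>norm v\<close>.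
\<close>

lemma norm_mono_jpositive:
  assumes "jpositive u" "jpositive (v - u)"
  shows "norm u \<le> norm (v :: 'a::unital_jb_algebra)"
proof (cases "(1::'a) = 0")
  case True
  then show ?thesis using trivial_algebra[OF True] by (metis norm_zero order_refl)
next
  case False
  have "jpositive (norm v *\<^sub>R 1 - v)"
    by (rule jpositive_if_norm_le[of "norm v"]) simp
  then have "jpositive ((norm v *\<^sub>R 1 - v) + (v - u))" using assms(2) by (rule jpositive_add)
  then have le: "\<mu> \<le> norm v" if "\<mu> \<in> jspectrum u" for \<mu>
    using that jspectrum_scaleR_one_diff[of "norm v - \<mu>" "norm v" u] by (auto simp: jpositive_def)
  have "norm u \<in> jspectrum u \<or> - norm u \<in> jspectrum u" by (rule norm_mem_jspectrum[OF False])
  then show ?thesis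
    using le assms(1) by (fastforce simp: jpositive_def)
qed

section \<open>The continuous functional calculus\<close>

lemma poly_approximation:
  fixes f :: "real \<Rightarrow> real"
  assumes "continuous_on {lo..hi} f" "e > 0"
  obtains q where "\<And>x. x \<in> {lo..hi} \<Longrightarrow> \<bar>f x - poly q x\<bar> < e"
proof -
  obtain g where g: "real_polynomial_function g" "\<And>x. x \<in> {lo..hi} \<Longrightarrow> \<bar>f x - g x\<bar> < e"
    using Stone_Weierstrass_real_polynomial_function[OF compact_Icc assms] by blast
  then obtain a n where a: "g = (\<lambda>x. \<Sum>i\<le>n. a i * x ^ i)"
    by (auto simp: real_polynomial_function_iff_sum)
  have "poly (\<Sum>i\<le>n. monom (a i) i) x = g x" for x
    by (simp add: a poly_sum poly_monom)
  with g that show thesis by metis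
qed

lemma norm_jpoly_diff_le:
  fixes A :: "'a::unital_jb_algebra"
  assumes "\<And>r. r \<in> jspectrum A \<Longrightarrow> \<bar>f r - poly p r\<bar> \<le> M" "\<And>r. r \<in> jspectrum A \<Longrightarrow> \<bar>f r - poly q r\<bar> \<le> N"
    and "0 \<le> M" "0 \<le> N"
  shows "norm (jpoly p A - jpoly q A) \<le> M + N"
proof -
  have "norm (jpoly (p - q) A) \<le> M + N"
    using assms by (intro norm_jpoly_le) (fastforce simp: abs_le_iff)+
  then show ?thesis by (simp add: jpoly_diff)
qed

text \<open>
  The functional calculus is used through this estimate alone. Polynomials that approximate \<open>f\<close> uniformly
  on an interval containing the spectrum have values at \<open>A\<close> that form a Cauchy sequence, and any two
  approximating sequences have the same limit; this is what the definite description in the functional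
  calculus requires.
\<close>

lemma norm_jcalc_diff_jpoly_le:
  fixes A :: "'a::unital_jb_algebra"
  assumes spec: "jspectrum A \<subseteq> {lo..hi}" and cont: "continuous_on {lo..hi} f"
    and M: "\<And>r. r \<in> jspectrum A \<Longrightarrow> \<bar>f r - poly q r\<bar> \<le> M" "0 \<le> M"
  shows "norm (jcalc f A - jpoly q A) \<le> M"
proof -
  have "\<forall>m. \<exists>p. \<forall>x\<in>{lo..hi}. \<bar>f x - poly p x\<bar> < inverse (real (Suc m))"
    using poly_approximation[OF cont] by (metis inverse_positive_iff_positive of_nat_0_less_iff zero_less_Suc)
  then obtain p where "\<And>m x. x \<in> {lo..hi} \<Longrightarrow> \<bar>f x - poly (p m) x\<bar> < inverse (real (Suc m))"
    by metis
  then have p: "\<bar>f x - poly (p m) x\<bar> \<le> inverse (real (Suc m))" if "x \<in> jspectrum A" for m x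
    using that spec by (meson less_imp_le subsetD)
  have inv0: "(\<lambda>m. inverse (real (Suc m))) \<longlonglongrightarrow> 0" by (rule LIMSEQ_inverse_real_of_nat)
  have p_lim: "uniform_limit (jspectrum A) (\<lambda>m. poly (p m)) f sequentially"
    unfolding uniform_limit_iff
  proof (intro allI impI)
    fix e :: real assume "e > 0"
    then have "\<forall>\<^sub>F m in sequentially. inverse (real (Suc m)) < e"
      using inv0 by (intro order_tendstoD)
    then show "\<forall>\<^sub>F m in sequentially. \<forall>x\<in>jspectrum A. dist (poly (p m) x) (f x) < e"
    proof eventually_elim
      case (elim m)
      show ?case
      proof
        fix x assume "x \<in> jspectrum A"
        then show "dist (poly (p m) x) (f x) < e"
          using p[of x m] elim by (simp add: dist_real_def abs_minus_commute)
      qed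
    qed
  qed
  have conv: "\<exists>L. (\<lambda>m. jpoly (p m) A) \<longlonglongrightarrow> L"
  proof -
    have "Cauchy (\<lambda>m. jpoly (p m) A)"
    proof (rule metric_CauchyI)
      fix e :: real assume "e > 0"
      then have "\<forall>\<^sub>F m in sequentially. inverse (real (Suc m)) < e / 2"
        using inv0 by (intro order_tendstoD) auto
      then obtain k where k: "\<And>m. m \<ge> k \<Longrightarrow> inverse (real (Suc m)) < e / 2"
        unfolding eventually_sequentially by blast
      show "\<exists>K. \<forall>m\<ge>K. \<forall>n\<ge>K. dist (jpoly (p m) A) (jpoly (p n) A) < e"
      proof (intro exI allI impI)
        fix m n assume "k \<le> m" "k \<le> n"
        then have "inverse (real (Suc m)) + inverse (real (Suc n)) < e" using k by (smt (verit) field_sum_of_halves)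
        moreover have "norm (jpoly (p m) A - jpoly (p n) A) \<le> inverse (real (Suc m)) + inverse (real (Suc n))"
          by (rule norm_jpoly_diff_le[of A f]) (use p in auto)
        ultimately show "dist (jpoly (p m) A) (jpoly (p n) A) < e" by (simp add: dist_norm)
      qed
    qed
    then show ?thesis by (auto simp: Cauchy_convergent_iff convergent_def)
  qed
  then obtain L where L: "(\<lambda>m. jpoly (p m) A) \<longlonglongrightarrow> L" by blast
  have L': "(\<lambda>m. jpoly (p' m) A) \<longlonglongrightarrow> L" if p': "uniform_limit (jspectrum A) (\<lambda>m. poly (p' m)) f sequentially" for p'
  proof -
    have "(\<lambda>m. jpoly (p' m) A - jpoly (p m) A) \<longlonglongrightarrow> 0"
    proof (rule tendstoI)
      fix e :: real assume "e > 0"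
      then have "\<forall>\<^sub>F m in sequentially. \<forall>x\<in>jspectrum A. dist (poly (p' m) x) (f x) < e / 3"
        "\<forall>\<^sub>F m in sequentially. \<forall>x\<in>jspectrum A. dist (poly (p m) x) (f x) < e / 3"
        using p' p_lim unfolding uniform_limit_iff by (meson divide_pos_pos zero_less_numeral)+
      then show "\<forall>\<^sub>F m in sequentially. dist (jpoly (p' m) A - jpoly (p m) A) 0 < e"
      proof eventually_elim
        case (elim m)
        then have "norm (jpoly (p' m) A - jpoly (p m) A) \<le> e/3 + e/3"
          using \<open>e > 0\<close> by (intro norm_jpoly_diff_le[of A f]) (fastforce simp: dist_real_def abs_minus_commute)+
        then show ?case using \<open>e > 0\<close> by simp
      qed
    qed
    from tendsto_add[OF this L] show ?thesis by simp
  qed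
  have "jcalc f A = L"
    unfolding jcalc_def by (rule the_equality) (use L L' p_lim LIMSEQ_unique in blast)+
  moreover have "norm (L - jpoly q A) \<le> M"
  proof (rule tendsto_le[OF trivial_limit_sequentially])
    show "(\<lambda>m. norm (jpoly (p m) A - jpoly q A)) \<longlonglongrightarrow> norm (L - jpoly q A)"
      by (intro tendsto_intros L)
    show "(\<lambda>m. inverse (real (Suc m)) + M) \<longlonglongrightarrow> M"
      using tendsto_add[OF inv0 tendsto_const[of M]] by simp
    show "\<forall>\<^sub>F m in sequentially. norm (jpoly (p m) A - jpoly q A) \<le> inverse (real (Suc m)) + M"
      by (intro always_eventually allI norm_jpoly_diff_le[of A f]) (use p M in auto)
  qed
  ultimately show ?thesis by simp
qed

section \<open>Jordan inverses\<close>

text \<open>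
  Associativity is not available here, as \<open>d\<close> need not lie in a commuting subalgebra with \<open>x\<close>; the
  recursion for powers takes its place.
\<close>

lemma jpower_Suc_annihilates:
  fixes x d :: "'a::unital_jb_algebra"
  assumes "x \<odot> d = 0" "(x \<odot> x) \<odot> d = 0"
  shows "jpower x (Suc n) \<odot> d = 0"
proof (induction n rule: less_induct)
  case (less n)
  show ?case
  proof (cases n)
    case 0
    then show ?thesis using assms by simp
  next
    case (Suc m)
    have "(x \<odot> x) \<odot> (jpower x m \<odot> d) = 0 \<and> x \<odot> (x \<odot> (jpower x m \<odot> d)) = 0"
    proof (cases m)
      case 0
      then show ?thesis using assms by (simp add: jprod.zero_right)
    next
      case (Suc k)
      then have "jpower x m \<odot> d = 0" using less[of k] \<open>n = Suc m\<close> by simp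
      then show ?thesis by (simp only: jprod.zero_right)
    qed
    then show ?thesis
      unfolding Suc jpower_Suc_Suc_jprod by (simp only: assms jprod.zero_right) simp
  qed
qed

text \<open>
  The difference \<open>d\<close> of two inverses is annihilated by \<open>x\<close> and \<open>x \<odot> x\<close>, hence by \<open>x \<odot> c\<close> for every \<open>c\<close> in
  the closed subalgebra generated by \<open>x\<close>. An inverse of \<open>x\<close> in that subalgebra is such a \<open>c\<close>, so \<open>1 \<odot> d = 0\<close>.
\<close>

lemma jinverse_unique:
  fixes x :: "'a::unital_jb_algebra"
  assumes "is_jinverse x y" "is_jinverse x z"
  shows "y = z"
proof -
  interpret commuting_subalgebra "generated_by x" by (rule commuting_subalgebra_generated_by)
  define d where "d = y - z"
  have d: "x \<odot> d = 0" "(x \<odot> x) \<odot> d = 0"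
    using assms by (simp_all add: d_def is_jinverse_def jprod.diff_right)
  have ann: "(x \<odot> jpoly p x) \<odot> d = 0" for p
    using jpower_Suc_annihilates[OF d]
    by (simp add: jpoly_def jprod.sum_right jprod.scaleR_right jprod.sum_left jprod.scaleR_left)
  have "unit_in x"
    using assms(1) jinvertible_iff_unit_in[OF mem_generated_by] by (auto simp: jinvertible_def)
  then obtain b where b: "b \<in> generated_by x" "x \<odot> b = 1" by (auto simp: unit_in_def)
  obtain p where p: "(\<lambda>m. jpoly (p m) x) \<longlonglongrightarrow> b" using b(1) by (rule generated_byE)
  have "(\<lambda>m. (x \<odot> jpoly (p m) x) \<odot> d) \<longlonglongrightarrow> (x \<odot> b) \<odot> d"
    by (intro jprod.tendsto p tendsto_const)
  then have "d = 0" using b(2) by (simp add: ann LIMSEQ_const_iff)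
  then show ?thesis by (simp add: d_def)
qed

lemma jinverse_eq: "is_jinverse x y \<Longrightarrow> jinverse x = y"
  unfolding jinverse_def by (rule the_equality) (auto intro: jinverse_unique)

text \<open>
  The inverse \<open>u\<close> of \<open>1 + h\<close> satisfies \<open>u = 1 - h \<odot> u\<close>, whence \<open>norm u \<le> 2\<close>. Substituting the equation
  into itself gives \<open>u = 1 - h + h \<odot> (h \<odot> u)\<close>.
\<close>

lemma norm_jinverse_one_add_le:
  fixes h :: "'a::unital_jb_algebra"
  assumes "norm h \<le> 1/2"
  shows "norm (jinverse (1 + h) - (1 - h)) \<le> 2 * (norm h)\<^sup>2"
proof -
  interpret commuting_subalgebra "generated_by h" by (rule commuting_subalgebra_generated_by)
  note h = mem_generated_by[of h]
  have "unit_in (1 - (-1) *\<^sub>R h)"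
    by (rule unit_in_one_diff[OF scaleR_mem[OF h]]) (use assms in simp)
  then obtain u where u: "u \<in> generated_by h" "(1 + h) \<odot> u = 1" by (auto simp: unit_in_def)
  have "is_jinverse (1 + h) u"
    using u h by (simp add: is_jinverse_def jprod_assoc mem)
  then have inv: "jinverse (1 + h) = u" by (rule jinverse_eq)
  have sum: "u + h \<odot> u = 1" using u by (simp add: jprod.add_left)
  then have eq: "u = 1 - h \<odot> u" and eq': "1 - u = h \<odot> u"
    by (metis add_diff_cancel_right', metis add_diff_cancel_left')
  have "norm u \<le> norm (1::'a) + norm (h \<odot> u)"
    by (subst eq) (rule norm_triangle_ineq4)
  also have "\<dots> \<le> 1 + 1/2 * norm u"
    using norm_one_le norm_jprod_le[of h u] mult_right_mono[OF assms norm_ge_zero[of u]] by (smt (verit))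
  finally have u2: "norm u \<le> 2" by simp
  have "u - (1 - h) = h - (1 - u)" by simp
  also have "\<dots> = h - h \<odot> u" by (simp only: eq')
  also have "\<dots> = h \<odot> (1 - u)" by (simp add: jprod.diff_right)
  finally have "norm (u - (1 - h)) = norm (h \<odot> (h \<odot> u))" by (simp only: eq')
  also have "\<dots> \<le> norm h * (norm h * norm u)"
    by (rule order_trans[OF norm_jprod_le mult_left_mono[OF norm_jprod_le norm_ge_zero]])
  also have "\<dots> \<le> norm h * (norm h * 2)"
    using u2 by (intro mult_left_mono) auto
  finally show ?thesis by (simp add: inv power2_eq_square mult.commute)
qed

section \<open>Curves through the unit\<close>

text \<open>
  Differentiability at \<open>0\<close> of a curve through \<open>1\<close>, as a limit of difference quotients. The value of the
  curve at \<open>0\<close> is left open, so that curves only have to be compared at \<open>t \<noteq> 0\<close>.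
\<close>

definition has_tangent_at_one :: "(real \<Rightarrow> 'a::unital_jb_algebra) \<Rightarrow> 'a \<Rightarrow> bool" where
  "has_tangent_at_one F D \<longleftrightarrow> ((\<lambda>t. (1 / t) *\<^sub>R (F t - 1)) \<longlongrightarrow> D) (at 0)"

lemma has_tangent_at_one_if_differentiable:
  assumes "F differentiable (at 0)" "F 0 = 1"
  shows "has_tangent_at_one F (vector_derivative F (at 0))"
proof -
  let ?v = "vector_derivative F (at 0)"
  have "(F has_vector_derivative ?v) (at 0)"
    using assms(1) by (simp add: vector_derivative_works)
  then have "((\<lambda>t. norm (F t - 1 - t *\<^sub>R ?v) / norm t) \<longlongrightarrow> 0) (at 0)"
    using assms(2) by (simp add: has_vector_derivative_def has_derivative_at)
  moreover have "\<forall>\<^sub>F t in at 0. norm ((1 / t) *\<^sub>R (F t - 1) - ?v) = norm (F t - 1 - t *\<^sub>R ?v) / norm t"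
  proof -
    have "norm ((1 / t) *\<^sub>R (F t - 1) - ?v) = norm (F t - 1 - t *\<^sub>R ?v) / norm t" if "t \<noteq> 0" for t
    proof -
      have "(1 / t) *\<^sub>R (F t - 1) - ?v = (1 / t) *\<^sub>R (F t - 1 - t *\<^sub>R ?v)"
        using that by (simp add: scaleR_diff_right)
      then show ?thesis by simp
    qed
    then show ?thesis by (simp add: eventually_at_filter)
  qed
  ultimately have "((\<lambda>t. norm ((1 / t) *\<^sub>R (F t - 1) - ?v)) \<longlongrightarrow> 0) (at 0)"
    by (simp only: tendsto_cong)
  then show ?thesis
    unfolding has_tangent_at_one_def using Lim_null tendsto_norm_zero_iff by blast
qed

lemma has_tangent_at_one_tendsto:
  assumes "has_tangent_at_one F D"
  shows "((\<lambda>t. F t - 1) \<longlongrightarrow> 0) (at 0)"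
proof -
  have "((\<lambda>t. t *\<^sub>R ((1 / t) *\<^sub>R (F t - 1))) \<longlongrightarrow> 0 *\<^sub>R D) (at 0)"
    using assms unfolding has_tangent_at_one_def by (intro tendsto_intros)
  moreover have "\<forall>\<^sub>F t in at 0. t *\<^sub>R ((1 / t) *\<^sub>R (F t - 1)) = F t - 1"
    by (simp add: eventually_at_filter)
  ultimately show ?thesis by (simp add: tendsto_cong)
qed

lemma has_tangent_at_one_convex_combination:
  fixes F :: "'k::finite \<Rightarrow> real \<Rightarrow> 'a::unital_jb_algebra"
  assumes "\<And>k. has_tangent_at_one (F k) (D k)" and "(\<Sum>k\<in>UNIV. c k) = 1"
  shows "has_tangent_at_one (\<lambda>t. \<Sum>k\<in>UNIV. c k *\<^sub>R F k t) (\<Sum>k\<in>UNIV. c k *\<^sub>R D k)"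
proof -
  have "(\<Sum>k\<in>UNIV. c k *\<^sub>R F k t) - 1 = (\<Sum>k\<in>UNIV. c k *\<^sub>R (F k t - 1))" for t
    using assms(2) by (simp add: scaleR_diff_right sum_subtractf flip: scaleR_left.sum)
  then have eq: "(1 / t) *\<^sub>R ((\<Sum>k\<in>UNIV. c k *\<^sub>R F k t) - 1) = (\<Sum>k\<in>UNIV. c k *\<^sub>R ((1 / t) *\<^sub>R (F k t - 1)))" for t
    by (simp add: scaleR_sum_right mult.commute)
  show ?thesis
    unfolding has_tangent_at_one_def eq
    by (intro tendsto_intros assms(1)[unfolded has_tangent_at_one_def])
qed

lemma has_tangent_at_one_jinverse:
  assumes "has_tangent_at_one F D"
  shows "has_tangent_at_one (\<lambda>t. jinverse (F t)) (- D)"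
proof -
  let ?Q = "\<lambda>t. (1 / t) *\<^sub>R (F t - 1)"
  let ?E = "\<lambda>t. (1 / t) *\<^sub>R (jinverse (F t) - (1 - (F t - 1)))"
  have F0: "((\<lambda>t. norm (F t - 1)) \<longlongrightarrow> 0) (at 0)"
    using has_tangent_at_one_tendsto[OF assms] by (rule tendsto_norm_zero)
  have Q: "(?Q \<longlongrightarrow> D) (at 0)" using assms by (simp add: has_tangent_at_one_def)
  have "\<forall>\<^sub>F t in at 0. norm (F t - 1) < 1/2"
    using F0 by (rule order_tendstoD) simp
  then have bound: "\<forall>\<^sub>F t in at 0. norm (?E t) \<le> 2 * norm (?Q t) * norm (F t - 1)"
  proof eventually_elim
    case (elim t)
    then have "norm (jinverse (F t) - (1 - (F t - 1))) \<le> 2 * (norm (F t - 1))\<^sup>2"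
      using norm_jinverse_one_add_le[of "F t - 1"] by simp
    then have "\<bar>1 / t\<bar> * norm (jinverse (F t) - (1 - (F t - 1))) \<le> \<bar>1 / t\<bar> * (2 * (norm (F t - 1))\<^sup>2)"
      by (rule mult_left_mono) simp
    then show ?case by (simp only: norm_scaleR power2_eq_square mult.assoc mult.left_commute)
  qed
  have "((\<lambda>t. 2 * norm (?Q t) * norm (F t - 1)) \<longlongrightarrow> 2 * norm D * 0) (at 0)"
    by (intro tendsto_intros Q F0)
  then have "((\<lambda>t. 2 * norm (?Q t) * norm (F t - 1)) \<longlongrightarrow> 0) (at 0)"
    by (simp only: mult_zero_right)
  with bound have "(?E \<longlongrightarrow> 0) (at 0)" by (rule Lim_null_comparison)
  from tendsto_diff[OF this Q] have "((\<lambda>t. ?E t - ?Q t) \<longlongrightarrow> - D) (at 0)"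
    by (simp only: diff_0)
  moreover have "?E t - ?Q t = (1 / t) *\<^sub>R (jinverse (F t) - 1)" for t
  proof -
    have "(jinverse (F t) - (1 - (F t - 1))) - (F t - 1) = jinverse (F t) - 1" by simp
    then show ?thesis by (simp only: flip: scaleR_diff_right)
  qed
  ultimately show ?thesis by (simp only: has_tangent_at_one_def)
qed

text \<open>
  Since \<open>0 \<preceq> A - M \<preceq> A - H\<close>, monotonicity of the norm bounds \<open>A - M\<close> by \<open>A - H\<close>, which is of smaller order
  than \<open>t\<close>.
\<close>

lemma has_tangent_at_one_squeeze:
  assumes H: "has_tangent_at_one H D" and A: "has_tangent_at_one A D"
    and between: "\<forall>\<^sub>F t in at 0. H t \<preceq> M t \<and> M t \<preceq> A t"
  shows "has_tangent_at_one M D"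
proof -
  let ?q = "\<lambda>F t. (1 / t) *\<^sub>R (F t - 1)"
  have lim: "((\<lambda>t. norm (?q A t - ?q H t)) \<longlongrightarrow> 0) (at 0)"
    using tendsto_norm_zero[OF tendsto_diff[OF A[unfolded has_tangent_at_one_def] H[unfolded has_tangent_at_one_def], simplified]]
    by simp
  have "\<forall>\<^sub>F t in at 0. norm (?q A t - ?q M t) \<le> norm (?q A t - ?q H t)"
    using between
  proof eventually_elim
    case (elim t)
    then have "norm (A t - M t) \<le> norm (A t - H t)"
      by (intro norm_mono_jpositive) (simp_all add: jle_def)
    then have "\<bar>1 / t\<bar> * norm (A t - M t) \<le> \<bar>1 / t\<bar> * norm (A t - H t)"
      by (rule mult_left_mono) simp
    then show ?case by (simp flip: scaleR_diff_right)
  qed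
  then have "((\<lambda>t. ?q A t - ?q M t) \<longlongrightarrow> 0) (at 0)"
    by (rule Lim_null_comparison[OF _ lim])
  from tendsto_diff[OF A[unfolded has_tangent_at_one_def] this]
  show ?thesis by (simp add: has_tangent_at_one_def)
qed

section \<open>Powers of curves and the exponential\<close>

text \<open>
  The logarithm of \<open>(1 + t x)\<^bsup>1/t\<^esup>\<close> differs from \<open>x\<close> by at most \<open>2 \<bar>t\<bar> x\<^sup>2\<close>, and \<open>exp\<close> is uniformly
  continuous on bounded intervals; the interval is enlarged by \<open>1\<close> to contain the logarithms as well.
\<close>

lemma powr_inverse_tendsto_exp_uniformly:
  fixes R \<epsilon> :: real
  assumes "R > 0" "\<epsilon> > 0"
  shows "\<forall>\<^sub>F t in at 0. \<forall>x. \<bar>x\<bar> \<le> R \<longrightarrow> \<bar>(1 + t * x) powr (1 / t) - exp x\<bar> < \<epsilon>"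
proof -
  have "uniformly_continuous_on {-(R+1)..R+1} (exp :: real \<Rightarrow> real)"
    by (intro compact_uniformly_continuous continuous_intros compact_Icc)
  then obtain \<delta> where \<delta>: "\<delta> > 0" "\<And>x y. \<lbrakk>x \<in> {-(R+1)..R+1}; y \<in> {-(R+1)..R+1}; \<bar>y - x\<bar> < \<delta>\<rbrakk> \<Longrightarrow> \<bar>exp y - exp x\<bar> < \<epsilon>"
    using assms(2) unfolding uniformly_continuous_on_def dist_real_def by metis
  have "((\<lambda>t::real. \<bar>t\<bar> * R) \<longlongrightarrow> 0) (at 0)"
    by (auto intro!: tendsto_eq_intros)
  then have "\<forall>\<^sub>F t in at 0. \<bar>t\<bar> * R < 1/2"
    by (rule order_tendstoD) simp
  moreover have "((\<lambda>t::real. 2 * \<bar>t\<bar> * R\<^sup>2) \<longlongrightarrow> 0) (at 0)"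
    by (auto intro!: tendsto_eq_intros)
  then have "\<forall>\<^sub>F t in at 0. 2 * \<bar>t\<bar> * R\<^sup>2 < min \<delta> 1"
    by (rule order_tendstoD) (use \<delta>(1) in simp)
  moreover have "\<forall>\<^sub>F t in at (0::real). t \<noteq> 0" by (simp add: eventually_at_filter)
  ultimately show ?thesis
  proof eventually_elim
    case (elim t)
    show ?case
    proof (intro allI impI)
      fix x :: real assume x: "\<bar>x\<bar> \<le> R"
      have tx: "\<bar>t * x\<bar> \<le> 1/2"
        using mult_left_mono[OF x abs_ge_zero[of t]] elim unfolding abs_mult by linarith
      define y where "y = ln (1 + t * x) / t"
      have "(1 + t * x) powr (1 / t) = exp y"
        using tx by (simp add: powr_def y_def)
      moreover have "\<bar>y - x\<bar> < min \<delta> 1"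
      proof -
        have "y - x = (ln (1 + t * x) - t * x) / t" using elim by (simp add: y_def field_simps)
        then have "\<bar>y - x\<bar> = \<bar>ln (1 + t * x) - t * x\<bar> / \<bar>t\<bar>" by simp
        also have "\<dots> \<le> 2 * (t * x)\<^sup>2 / \<bar>t\<bar>"
          using abs_ln_one_plus_x_minus_x_bound[OF tx] by (intro divide_right_mono) auto
        also have "\<dots> = 2 * \<bar>t\<bar> * x\<^sup>2"
          using elim by (simp add: power2_eq_square field_simps)
        also have "\<dots> \<le> 2 * \<bar>t\<bar> * R\<^sup>2"
          using x by (intro mult_left_mono) (auto simp: abs_le_square_iff[symmetric])
        finally show ?thesis using elim by linarith
      qed
      ultimately show "\<bar>(1 + t * x) powr (1 / t) - exp x\<bar> < \<epsilon>"
        using \<delta>(2)[of x y] x by (auto simp: abs_le_iff abs_less_iff)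
    qed
  qed
qed

text \<open>
  Write \<open>M t = 1 + t X\<close> with \<open>X\<close> tending to \<open>D\<close>, and let \<open>q\<close> be a polynomial close to \<open>exp\<close> on an interval
  that contains the spectra of \<open>X\<close> and \<open>D\<close>. Then \<open>q D\<close> is close to \<open>jexp D\<close>, and \<open>q X\<close> is close to \<open>q D\<close> by
  continuity. As \<open>q X\<close> is also the polynomial \<open>x \<mapsto> q ((x - 1) / t)\<close> evaluated at \<open>M t\<close>, it is compared with
  the power of \<open>M t\<close> within the functional calculus of the single element \<open>M t\<close>.
\<close>

lemma tendsto_jpowr_inverse:
  fixes M :: "real \<Rightarrow> 'a::unital_jb_algebra"
  assumes "has_tangent_at_one M D"
  shows "((\<lambda>t. jpowr (M t) (1 / t)) \<longlongrightarrow> jexp D) (at 0)"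
proof (rule tendstoI)
  fix \<epsilon> :: real assume \<epsilon>: "\<epsilon> > 0"
  define R where "R = norm D + 1"
  have R: "R > 0" unfolding R_def using norm_ge_zero[of D] by linarith
  define X where "X = (\<lambda>t. (1 / t) *\<^sub>R (M t - 1))"
  have X: "(X \<longlongrightarrow> D) (at 0)" using assms by (simp add: has_tangent_at_one_def X_def)
  have exp_cont: "continuous_on {-R..R} (exp :: real \<Rightarrow> real)" by (intro continuous_intros)
  have "\<epsilon> / 4 > 0" using \<epsilon> by simp
  from poly_approximation[OF exp_cont this]
  obtain q where q: "\<And>x. x \<in> {-R..R} \<Longrightarrow> \<bar>exp x - poly q x\<bar> < \<epsilon> / 4"
    by blast
  have exp_D: "norm (jexp D - jpoly q D) \<le> \<epsilon> / 4"
  proof -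
    have spec: "jspectrum D \<subseteq> {-R..R}" using jspectrum_subset[of D 0] by (auto simp: R_def)
    show ?thesis
      unfolding jexp_def
    proof (rule norm_jcalc_diff_jpoly_le[OF spec exp_cont])
      fix r assume "r \<in> jspectrum D"
      then show "\<bar>exp r - poly q r\<bar> \<le> \<epsilon> / 4"
        using q spec by (meson less_imp_le subsetD)
    qed (use \<epsilon> in simp)
  qed
  have "\<forall>\<^sub>F t in at 0. norm (X t) < R"
    using tendsto_norm[OF X] by (rule order_tendstoD) (simp add: R_def)
  moreover have "\<forall>\<^sub>F t in at 0. dist (jpoly q (X t)) (jpoly q D) < \<epsilon> / 4"
    using tendsto_jpoly[OF X] \<epsilon> by (intro tendstoD) auto
  moreover have "\<forall>\<^sub>F t in at 0. \<forall>x. \<bar>x\<bar> \<le> R \<longrightarrow> \<bar>(1 + t * x) powr (1 / t) - exp x\<bar> < \<epsilon> / 4"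
    using R \<epsilon> by (intro powr_inverse_tendsto_exp_uniformly) auto
  moreover have "\<forall>\<^sub>F t in at 0. norm (M t - 1) < 1/2"
    using tendsto_norm_zero[OF has_tangent_at_one_tendsto[OF assms]] by (rule order_tendstoD) simp
  moreover have "\<forall>\<^sub>F t in at (0::real). t \<noteq> 0" by (simp add: eventually_at_filter)
  ultimately show "\<forall>\<^sub>F t in at 0. dist (jpowr (M t) (1 / t)) (jexp D) < \<epsilon>"
  proof eventually_elim
    case (elim t)
    note near_one = elim(4) and t = elim(5)
    let ?p = "pcompose q [:- (1 / t), 1 / t:]"
    have q_X: "jpoly q (X t) = jpoly ?p (M t)"
      by (simp add: jpoly_pcompose jpoly_linear X_def scaleR_diff_right)
    have "norm (jpowr (M t) (1 / t) - jpoly ?p (M t)) \<le> \<epsilon> / 2"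
      unfolding jpowr_def
    proof (rule norm_jcalc_diff_jpoly_le)
      show "jspectrum (M t) \<subseteq> {1/2..3/2}"
        using jspectrum_subset[of "M t" 1] near_one by auto
      show "continuous_on {1/2..3/2::real} (\<lambda>x. x powr (1 / t))"
        by (intro continuous_intros) auto
      show "0 \<le> \<epsilon> / 2" using \<epsilon> by simp
      fix r assume r: "r \<in> jspectrum (M t)"
      define x where "x = (r - 1) / t"
      have "\<bar>r - 1\<bar> \<le> norm (M t - 1)"
        using subsetD[OF jspectrum_subset[of "M t" 1] r] by (auto simp: abs_le_iff)
      also have "\<dots> = \<bar>t\<bar> * norm (X t)" using t by (simp add: X_def)
      finally have "\<bar>x\<bar> \<le> norm (X t)" using t by (simp add: x_def field_simps)
      then have x: "\<bar>x\<bar> \<le> R" using elim(1) by simp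
      have "r = 1 + t * x" "poly ?p r = poly q x"
        using t by (simp_all add: x_def poly_pcompose field_simps)
      moreover have "\<bar>(1 + t * x) powr (1 / t) - exp x\<bar> < \<epsilon> / 4"
        using elim(3) x by blast
      moreover have "\<bar>exp x - poly q x\<bar> < \<epsilon> / 4"
        by (rule q) (use x in \<open>simp add: abs_le_iff\<close>)
      ultimately have "\<bar>r powr (1 / t) - exp x\<bar> < \<epsilon> / 4" "\<bar>exp x - poly ?p r\<bar> < \<epsilon> / 4"
        by (simp_all only:)
      then show "\<bar>r powr (1 / t) - poly ?p r\<bar> \<le> \<epsilon> / 2" by linarith
    qed
    then have "norm (jpowr (M t) (1 / t) - jpoly q (X t)) \<le> \<epsilon> / 2" by (simp add: q_X)
    moreover have "norm (jpoly q (X t) - jpoly q D) < \<epsilon> / 4" using elim(2) by (simp add: dist_norm)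
    moreover have "norm (jpowr (M t) (1 / t) - jexp D) \<le> norm (jpowr (M t) (1 / t) - jpoly q (X t))
        + norm (jpoly q (X t) - jpoly q D) + norm (jexp D - jpoly q D)"
    proof -
      have "norm (a + b - c) \<le> norm a + norm b + norm c" for a b c :: 'a
        by (rule order_trans[OF norm_triangle_ineq4]) (simp add: norm_triangle_ineq)
      from this[of "jpowr (M t) (1 / t) - jpoly q (X t)" "jpoly q (X t) - jpoly q D" "jexp D - jpoly q D"]
      show ?thesis by simp
    qed
    ultimately have "norm (jpowr (M t) (1 / t) - jexp D) < \<epsilon>"
      using exp_D by linarith
    then show ?case by (simp add: dist_norm)
  qed
qed

theorem theorem5p2:
  fixes w :: "real ^ 'n"
    and G :: "'a::unital_jb_algebra ^ 'n \<Rightarrow> 'a"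
  assumes "CARD('n) \<ge> 2"
    and "w \<in> prob_vectors"
    and "weighted_mean G"
    and "\<And>A. (\<And>k. A $ k \<in> pos_cone) \<Longrightarrow>
           jinverse (\<Sum>k\<in>UNIV. w $ k *\<^sub>R jinverse (A $ k)) \<preceq> G A \<and>
           G A \<preceq> (\<Sum>k\<in>UNIV. w $ k *\<^sub>R A $ k)"
  shows "lie_trotter_mean w G"
  unfolding lie_trotter_mean_def
proof (intro conjI allI impI assms(3))
  fix \<gamma> :: "'n \<Rightarrow> real \<Rightarrow> 'a" and e :: real
  assume e: "e > 0"
    and \<gamma>: "\<forall>k. \<gamma> k ` {-e<..<e} \<subseteq> pos_cone \<and> \<gamma> k differentiable_on {-e<..<e} \<and> \<gamma> k 0 = 1"
  define D where "D = (\<Sum>k\<in>UNIV. w $ k *\<^sub>R vector_derivative (\<gamma> k) (at 0))"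
  have w: "(\<Sum>k\<in>UNIV. w $ k) = 1" using assms(2) by (simp add: prob_vectors_def)
  have tangent: "has_tangent_at_one (\<gamma> k) (vector_derivative (\<gamma> k) (at 0))" for k
  proof (rule has_tangent_at_one_if_differentiable)
    show "\<gamma> k differentiable (at 0)"
      using \<gamma> e differentiable_on_eq_differentiable_at[of "{-e<..<e}" "\<gamma> k"] by auto
  qed (use \<gamma> in simp)
  have arith: "has_tangent_at_one (\<lambda>t. \<Sum>k\<in>UNIV. w $ k *\<^sub>R \<gamma> k t) D"
    unfolding D_def by (intro has_tangent_at_one_convex_combination tangent w)
  have "has_tangent_at_one (\<lambda>t. \<Sum>k\<in>UNIV. w $ k *\<^sub>R jinverse (\<gamma> k t))
     (\<Sum>k\<in>UNIV. w $ k *\<^sub>R - vector_derivative (\<gamma> k) (at 0))"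
    by (intro has_tangent_at_one_convex_combination has_tangent_at_one_jinverse tangent w)
  then have harm: "has_tangent_at_one (\<lambda>t. jinverse (\<Sum>k\<in>UNIV. w $ k *\<^sub>R jinverse (\<gamma> k t))) D"
    using has_tangent_at_one_jinverse by (fastforce simp: D_def sum_negf)
  have "\<forall>\<^sub>F t in at 0. t \<in> {-e<..<e}"
    using e by (intro eventually_at_in_open') auto
  then have "\<forall>\<^sub>F t in at 0. jinverse (\<Sum>k\<in>UNIV. w $ k *\<^sub>R jinverse (\<gamma> k t)) \<preceq> G (\<chi> k. \<gamma> k t) \<and>
      G (\<chi> k. \<gamma> k t) \<preceq> (\<Sum>k\<in>UNIV. w $ k *\<^sub>R \<gamma> k t)"
  proof eventually_elim
    case (elim t)
    then have "(\<chi> k. \<gamma> k t) $ k \<in> pos_cone" for k using \<gamma> by (simp add: image_subset_iff)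
    from assms(4)[OF this] show ?case by simp
  qed
  then have "has_tangent_at_one (\<lambda>t. G (\<chi> k. \<gamma> k t)) D"
    by (rule has_tangent_at_one_squeeze[OF harm arith])
  then show "((\<lambda>t. jpowr (G (\<chi> k. \<gamma> k t)) (1 / t)) \<longlongrightarrow>
      jexp (\<Sum>k\<in>UNIV. w $ k *\<^sub>R vector_derivative (\<gamma> k) (at 0))) (at 0)"
    unfolding D_def by (rule tendsto_jpowr_inverse)
qed

end
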